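(* For every countable field $K$ there are valuation domains $R_1$ and $R_2$, both of cardinality $\aleph_1$, both with residue field (isomorphic to) $K$ and with the same value group, such that their quotient fields $Q_1$ and $Q_2$ are generated as $R_1$-, resp. $R_2$-modules by $\aleph_1$ but not by countably many elements, and such that the type $Q_1/R_1$ is essentially uncountable and the type $Q_2/R_2$ is strongly countable.
   Context: A valuation domain is an integral domain whose ideals are linearly ordered by inclusion; its quotient field is denoted $Q$ (with $Q\neq R$). For a valuation domain $R$ of cardinality $\aleph_1$ and an $R$-submodule $J$ of $Q$ with $R\subseteq J$ which is not countably generated, write $J=\bigcup_{\sigma<\omega_1} r_\sigma^{-1}R$ with nonzero $r_\sigma\in R$ such that for $\tau<\sigma$, $r_\tau\mid r_\sigma$ and $r_\sigma\nmid r_\tau$. The type $J/R$ is essentially uncountable if for every $\sigma<\omega_1$ there is $\tau>\sigma$ with $r_\sigma R/r_\tau R$ uncountable; otherwise it is essentially countable. It is strongly countable if $R/r_\sigma R$ is countable for every $\sigma<\omega_1$. These notions are independent of the choice of the $r_\sigma$. *)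

theory Defs
  imports "HOL-Algebra.Algebra"
begin

text \<open>aleph_1 is the cardinal successor of the cardinal of nat; as a well-order,
  cardSuc natLeq is (a copy of) the initial ordinal omega_1, with field omega1_idx.\<close>

abbreviation aleph1 :: "nat set rel" where
  "aleph1 \<equiv> cardSuc natLeq"

abbreviation omega1_idx :: "nat set set" where
  "omega1_idx \<equiv> Field aleph1"

definition card_eq_aleph1 :: "'a set \<Rightarrow> bool" where
  "card_eq_aleph1 A \<longleftrightarrow> (card_of A, aleph1) \<in> ordIso"

definition card_le_aleph1 :: "'a set \<Rightarrow> bool" where
  "card_le_aleph1 A \<longleftrightarrow> (card_of A, aleph1) \<in> ordLeq"

abbreviation subring_ring :: "('a, 'b) ring_scheme \<Rightarrow> 'a set \<Rightarrow> ('a, 'b) ring_scheme" where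
  "subring_ring Q R \<equiv> Q\<lparr>carrier := R\<rparr>"

definition quotient_field_of :: "('a, 'b) ring_scheme \<Rightarrow> 'a set \<Rightarrow> bool" where
  "quotient_field_of Q R \<longleftrightarrow> field Q \<and> subring R Q \<and>
     (\<forall>x\<in>carrier Q. \<exists>a\<in>R. \<exists>b\<in>R. b \<noteq> \<zero>\<^bsub>Q\<^esub> \<and> x = a \<otimes>\<^bsub>Q\<^esub> inv\<^bsub>Q\<^esub> b)"

definition valuation_domain :: "('a, 'b) ring_scheme \<Rightarrow> bool" where
  "valuation_domain R \<longleftrightarrow> domain R \<and>
     (\<forall>I J. ideal I R \<longrightarrow> ideal J R \<longrightarrow> I \<subseteq> J \<or> J \<subseteq> I)"

text \<open>R is a valuation domain with quotient field Q, and Q is different from R (standing assumption).\<close>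
definition valuation_domain_in :: "('a, 'b) ring_scheme \<Rightarrow> 'a set \<Rightarrow> bool" where
  "valuation_domain_in Q R \<longleftrightarrow> quotient_field_of Q R \<and> valuation_domain (subring_ring Q R)
     \<and> R \<noteq> carrier Q"

definition max_ideal :: "('a, 'b) ring_scheme \<Rightarrow> 'a set \<Rightarrow> 'a set" where
  "max_ideal Q R = R - Units (subring_ring Q R)"

definition residue_field :: "('a, 'b) ring_scheme \<Rightarrow> 'a set \<Rightarrow> 'a set ring" where
  "residue_field Q R = (subring_ring Q R) Quot (max_ideal Q R)"

definition value_group :: "('a, 'b) ring_scheme \<Rightarrow> 'a set \<Rightarrow> 'a set monoid" where
  "value_group Q R = (mult_of Q) Mod (Units (subring_ring Q R))"

definition value_le :: "('a, 'b) ring_scheme \<Rightarrow> 'a set \<Rightarrow> 'a set \<Rightarrow> 'a set \<Rightarrow> bool" where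
  "value_le Q R A B \<longleftrightarrow> (\<exists>a\<in>A. \<exists>b\<in>B. b \<otimes>\<^bsub>Q\<^esub> inv\<^bsub>Q\<^esub> a \<in> R)"

definition same_value_group ::
  "('a, 'b) ring_scheme \<Rightarrow> 'a set \<Rightarrow> ('c, 'd) ring_scheme \<Rightarrow> 'c set \<Rightarrow> bool" where
  "same_value_group Q1 R1 Q2 R2 \<longleftrightarrow>
     (\<exists>\<phi>. \<phi> \<in> iso (value_group Q1 R1) (value_group Q2 R2) \<and>
        (\<forall>A\<in>carrier (value_group Q1 R1). \<forall>B\<in>carrier (value_group Q1 R1).
            value_le Q1 R1 A B \<longleftrightarrow> value_le Q2 R2 (\<phi> A) (\<phi> B)))"

definition rspan :: "('a, 'b) ring_scheme \<Rightarrow> 'a set \<Rightarrow> 'a set \<Rightarrow> 'a set" where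
  "rspan Q R S = {finsum Q (\<lambda>s. c s \<otimes>\<^bsub>Q\<^esub> s) F | F c. finite F \<and> F \<subseteq> S \<and> c \<in> F \<rightarrow> R}"

definition principal :: "('a, 'b) ring_scheme \<Rightarrow> 'a set \<Rightarrow> 'a \<Rightarrow> 'a set" where
  "principal Q R r = {r \<otimes>\<^bsub>Q\<^esub> x | x. x \<in> R}"

definition rdvd :: "('a, 'b) ring_scheme \<Rightarrow> 'a set \<Rightarrow> 'a \<Rightarrow> 'a \<Rightarrow> bool" where
  "rdvd Q R a b \<longleftrightarrow> (\<exists>x\<in>R. b = a \<otimes>\<^bsub>Q\<^esub> x)"

definition cosets_in :: "('a, 'b) ring_scheme \<Rightarrow> 'a set \<Rightarrow> 'a set \<Rightarrow> 'a set set" where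
  "cosets_in Q M N = {(\<lambda>y. a \<oplus>\<^bsub>Q\<^esub> y) ` N | a. a \<in> M}"

definition omega1_rep :: "('a, 'b) ring_scheme \<Rightarrow> 'a set \<Rightarrow> 'a set \<Rightarrow> (nat set \<Rightarrow> 'a) \<Rightarrow> bool" where
  "omega1_rep Q R J r \<longleftrightarrow>
     (\<forall>\<sigma>\<in>omega1_idx. r \<sigma> \<in> R \<and> r \<sigma> \<noteq> \<zero>\<^bsub>Q\<^esub>) \<and>
     (\<forall>\<tau>\<in>omega1_idx. \<forall>\<sigma>\<in>omega1_idx. (\<tau>, \<sigma>) \<in> aleph1 \<and> \<tau> \<noteq> \<sigma> \<longrightarrow>
         rdvd Q R (r \<tau>) (r \<sigma>) \<and> \<not> rdvd Q R (r \<sigma>) (r \<tau>)) \<and>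
     J = (\<Union>\<sigma>\<in>omega1_idx. principal Q R (inv\<^bsub>Q\<^esub> (r \<sigma>)))"

definition essentially_uncountable_type :: "('a, 'b) ring_scheme \<Rightarrow> 'a set \<Rightarrow> 'a set \<Rightarrow> bool" where
  "essentially_uncountable_type Q R J \<longleftrightarrow> (\<exists>r. omega1_rep Q R J r) \<and>
     (\<forall>r. omega1_rep Q R J r \<longrightarrow>
        (\<forall>\<sigma>\<in>omega1_idx. \<exists>\<tau>\<in>omega1_idx. (\<sigma>, \<tau>) \<in> aleph1 \<and> \<sigma> \<noteq> \<tau> \<and>
           \<not> countable (cosets_in Q (principal Q R (r \<sigma>)) (principal Q R (r \<tau>)))))"

definition strongly_countable_type :: "('a, 'b) ring_scheme \<Rightarrow> 'a set \<Rightarrow> 'a set \<Rightarrow> bool" where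
  "strongly_countable_type Q R J \<longleftrightarrow> (\<exists>r. omega1_rep Q R J r) \<and>
     (\<forall>r. omega1_rep Q R J r \<longrightarrow>
        (\<forall>\<sigma>\<in>omega1_idx. countable (cosets_in Q R (principal Q R (r \<sigma>)))))"

end

theory Submission
  imports Defs "HOL-Library.Poly_Mapping" "HOL-Library.Set_Algebras"
begin

text \<open>
  The value group is the group of finitely supported functions from \<open>\<omega>\<^sub>1\<close> to the integers, ordered
  by the coefficient of the largest index at which two functions differ. Its cofinality is \<open>\<omega>\<^sub>1\<close>,
  while each element lies in a countable convex subgroup \<open>H\<close>. The Hahn series over \<open>K\<close> with these
  exponents form a valued field; \<open>Q\<^sub>2\<close> is its subfield generated by the monomials, and \<open>Q\<^sub>1\<close> is
  generated by the monomials and \<open>\<aleph>\<^sub>1\<close> power series in one monomial. Two elements of a valuation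
  ring agree modulo the elements of value at least \<open>g\<close> iff their coefficients agree below \<open>g\<close>. Hence
  the power series remain distinct modulo every element whose value exceeds all their exponents, and
  \<open>Q\<^sub>1/R\<^sub>1\<close> is essentially uncountable. Restricting series with nonnegative exponents to \<open>H\<close> is
  multiplicative, so it maps elements of \<open>R\<^sub>2\<close> to quotients of finite series with exponents in \<open>H\<close>.
  Since \<open>H\<close> and \<open>K\<close> are countable, only countably many residues remain, and \<open>Q\<^sub>2/R\<^sub>2\<close> is strongly
  countable.
\<close>

section \<open>Countable sets and the first uncountable cardinal\<close>

lemma countable_image_factor:
  assumes "countable (f ` A)" and factor: "\<And>x y. x \<in> A \<Longrightarrow> y \<in> A \<Longrightarrow> f x = f y \<Longrightarrow> h x = h y"
  shows "countable (h ` A)"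
proof -
  have "h x = h (inv_into A f (f x))" if "x \<in> A" for x
    using that by (intro factor) (auto simp: inv_into_into f_inv_into_f)
  then have "h ` A = (\<lambda>y. h (inv_into A f y)) ` f ` A"
    unfolding image_image by (rule image_cong[OF refl])
  then show ?thesis using assms(1) by simp
qed

lemma countable_iff_ordLeq_natLeq: "countable A \<longleftrightarrow> |A| \<le>o natLeq"
proof -
  have "countable A \<longleftrightarrow> |A| \<le>o |UNIV :: nat set|"
    unfolding countable_def card_of_ordLeq[symmetric] by simp
  then show ?thesis
    using ordLeq_ordIso_trans[OF _ card_of_nat]
      ordLeq_ordIso_trans[OF _ ordIso_symmetric[OF card_of_nat]]
    by blast
qed

lemma countable_iff_ordLess_aleph1: "countable A \<longleftrightarrow> |A| <o aleph1"
  by (simp add: countable_iff_ordLeq_natLeq cardSuc_ordLeq_ordLess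
      natLeq_Card_order card_of_Card_order)

lemma Cinfinite_aleph1: "Cinfinite aleph1"
  by (simp add: Cinfinite_cardSuc natLeq_Cinfinite)

lemma countable_Cinfinite_bound: "countable A \<Longrightarrow> Cinfinite r \<Longrightarrow> |A| \<le>o r"
  unfolding countable_iff_ordLeq_natLeq by (rule ordLeq_transitive[OF _ natLeq_ordLeq_cinfinite])

lemma ordLeq_image: "|A| \<le>o r \<Longrightarrow> |f ` A| \<le>o r"
  by (rule ordLeq_transitive[OF card_of_image])

lemma Times_Cinfinite_bound: "|A| \<le>o r \<Longrightarrow> |B| \<le>o r \<Longrightarrow> Cinfinite r \<Longrightarrow> |A \<times> B| \<le>o r"
  by (simp add: card_of_Times_ordLeq_infinite_Field cinfinite_def)

lemma Fpow_Cinfinite_bound: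
  assumes "|A| \<le>o r" "Cinfinite r"
  shows "|Fpow A| \<le>o r"
proof -
  have r: "|Field r| =o r" "infinite (Field r)"
    using assms(2) by (simp_all add: card_of_Field_ordIso cinfinite_def)
  have "|A| \<le>o |Field r|"
    using assms(1) r(1) by (blast intro: ordLeq_ordIso_trans ordIso_symmetric)
  then have "|Fpow A| \<le>o |Fpow (Field r)|" by (rule card_of_Fpow_mono)
  also have "|Fpow (Field r)| =o |Field r|" using r(2) by (rule card_of_Fpow_infinite)
  also note r(1)
  finally show ?thesis .
qed

definition finite_support_functions :: "'b \<Rightarrow> 'a set \<Rightarrow> 'b set \<Rightarrow> ('a \<Rightarrow> 'b) set" where
  "finite_support_functions z A B = {f. finite {x. f x \<noteq> z} \<and> (\<forall>x. f x \<noteq> z \<longrightarrow> x \<in> A \<and> f x \<in> B)}"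

lemma finite_support_functions_ordLeq_Fpow: "|finite_support_functions z A B| \<le>o |Fpow (A \<times> B)|"
proof (rule card_of_ordLeqI)
  let ?graph = "\<lambda>f. (\<lambda>x. (x, f x)) ` {x. f x \<noteq> z}"
  have mem: "(x, y) \<in> ?graph f \<longleftrightarrow> f x = y \<and> y \<noteq> z" for x y f by auto
  show "inj_on ?graph (finite_support_functions z A B)"
  proof (intro inj_onI ext)
    fix f g x assume "?graph f = ?graph g"
    then show "f x = g x" using mem[of x _ f] mem[of x _ g] by metis
  qed
  show "?graph f \<in> Fpow (A \<times> B)" if "f \<in> finite_support_functions z A B" for f
    using that by (auto simp: finite_support_functions_def Fpow_def)
qed

lemma countable_finite_support_functions:
  assumes "countable A" "countable B"
  shows "countable (finite_support_functions z A B)"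
proof -
  have "countable (Fpow (A \<times> B))" using assms by (simp add: countable_Fpow)
  then show ?thesis
    unfolding countable_iff_ordLeq_natLeq
    by (rule ordLeq_transitive[OF finite_support_functions_ordLeq_Fpow])
qed

lemma finite_support_functions_Cinfinite_bound:
  assumes "|A| \<le>o r" "|B| \<le>o r" "Cinfinite r"
  shows "|finite_support_functions z A B| \<le>o r"
  using assms
  by (intro ordLeq_transitive[OF finite_support_functions_ordLeq_Fpow]
      Fpow_Cinfinite_bound Times_Cinfinite_bound)

subsection \<open>The reversed order on the countable ordinals\<close>

typedef omega1 = omega1_idx
  using Cinfinite_aleph1 by (metis cinfinite_def finite.emptyI ex_in_conv)

text \<open>Finitely supported functions are ordered by their values at the smallest index where they
  differ; the value group needs the largest ordinal to dominate, hence the reversal.\<close>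

instantiation omega1 :: linorder
begin
definition less_eq_omega1 :: "omega1 \<Rightarrow> omega1 \<Rightarrow> bool" where
  "\<sigma> \<le> \<tau> \<longleftrightarrow> (Rep_omega1 \<tau>, Rep_omega1 \<sigma>) \<in> aleph1"
definition less_omega1 :: "omega1 \<Rightarrow> omega1 \<Rightarrow> bool" where
  "\<sigma> < \<tau> \<longleftrightarrow> \<sigma> \<le> \<tau> \<and> \<not> \<tau> \<le> (\<sigma>::omega1)"
instance
proof
  have "Linear_order aleph1"
    using Cinfinite_aleph1 unfolding card_order_on_def well_order_on_def by simp
  then have order: "Refl aleph1" "trans aleph1" "antisym aleph1" "Total aleph1"
    by (simp_all add: order_on_defs)
  fix \<sigma> \<tau> \<upsilon> :: omega1
  show "(\<sigma> < \<tau>) = (\<sigma> \<le> \<tau> \<and> \<not> \<tau> \<le> \<sigma>)" by (rule less_omega1_def)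
  show refl: "\<sigma> \<le> \<sigma>" for \<sigma> :: omega1
    using order(1) Rep_omega1 by (auto simp: less_eq_omega1_def refl_on_def)
  show "\<sigma> \<le> \<upsilon>" if "\<sigma> \<le> \<tau>" "\<tau> \<le> \<upsilon>"
    using that order(2) unfolding less_eq_omega1_def trans_def by blast
  show "\<sigma> = \<tau>" if "\<sigma> \<le> \<tau>" "\<tau> \<le> \<sigma>"
    using that order(3) unfolding less_eq_omega1_def antisym_def by (metis Rep_omega1_inject)
  show "\<sigma> \<le> \<tau> \<or> \<tau> \<le> \<sigma>"
    using order(4) Rep_omega1 refl unfolding less_eq_omega1_def total_on_def by metis
qed
end

lemma omega1_less_iff_aleph1:
  assumes "\<sigma> \<in> omega1_idx" "\<tau> \<in> omega1_idx"
  shows "Abs_omega1 \<tau> < Abs_omega1 \<sigma> \<longleftrightarrow> (\<sigma>, \<tau>) \<in> aleph1 \<and> \<sigma> \<noteq> \<tau>"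
  using assms unfolding less_le less_eq_omega1_def
  by (auto simp: Abs_omega1_inverse Abs_omega1_inject)

lemma card_of_omega1: "|UNIV :: omega1 set| =o aleph1"
proof -
  have "bij_betw Rep_omega1 UNIV omega1_idx"
    by (metis bij_betw_def inj_on_def Rep_omega1_inject type_definition.Rep_range type_definition_omega1)
  then have "|UNIV :: omega1 set| =o |omega1_idx|" by (rule card_of_ordIsoI)
  also have "|omega1_idx| =o aleph1" by (simp add: card_of_Field_ordIso Cinfinite_aleph1)
  finally show ?thesis .
qed

lemma uncountable_omega1_idx: "uncountable omega1_idx"
proof -
  have "|omega1_idx| =o aleph1" by (simp add: card_of_Field_ordIso Cinfinite_aleph1)
  then show ?thesis by (metis countable_iff_ordLess_aleph1 not_ordLess_ordIso)
qed

lemma countable_omega1_greaterThan: "countable {\<sigma>::omega1<..}"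
proof -
  have "countable (underS aleph1 (Rep_omega1 \<sigma>))"
    unfolding countable_iff_ordLess_aleph1
    by (intro card_of_underS Rep_omega1 conjunct2[OF Cinfinite_aleph1])
  then have "countable (Rep_omega1 ` {\<sigma><..})"
    by (rule countable_subset[rotated])
      (auto simp: underS_def less_omega1_def less_eq_omega1_def Rep_omega1_inject)
  then show ?thesis
    by (rule countable_image_inj_on) (simp add: inj_on_def Rep_omega1_inject)
qed

lemma countable_omega1_strict_lower_bound:
  assumes "countable (S :: omega1 set)"
  obtains \<sigma> where "\<And>\<tau>. \<tau> \<in> S \<Longrightarrow> \<sigma> < \<tau>"
proof -
  have "countable {\<tau>..}" for \<tau> :: omega1
    using countable_omega1_greaterThan[of \<tau>] by (simp add: ivl_disj_un_singleton(1)[symmetric])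
  then have "countable (\<Union>\<tau>\<in>S. {\<tau>..})" using assms by blast
  moreover have "uncountable (UNIV :: omega1 set)"
    using card_of_omega1 by (metis countable_iff_ordLess_aleph1 not_ordLess_ordIso)
  ultimately obtain \<sigma> where "\<sigma> \<notin> (\<Union>\<tau>\<in>S. {\<tau>..})" by (metis UNIV_eq_I)
  then have "\<sigma> < \<tau>" if "\<tau> \<in> S" for \<tau> using that by force
  then show thesis by (rule that)
qed

section \<open>The value group\<close>

definition convex_subgroup :: "'g::linordered_ab_group_add set \<Rightarrow> bool" where
  "convex_subgroup H \<longleftrightarrow> 0 \<in> H \<and> (\<forall>a\<in>H. \<forall>b\<in>H. a - b \<in> H) \<and> (\<forall>a\<in>H. \<forall>b. 0 \<le> b \<and> b \<le> a \<longrightarrow> b \<in> H)"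

type_synonym value_grp = "omega1 \<Rightarrow>\<^sub>0 int"

lemma value_grp_less_iff:
  fixes g h :: value_grp
  shows "g < h \<longleftrightarrow> (\<exists>\<sigma>. Poly_Mapping.lookup g \<sigma> < Poly_Mapping.lookup h \<sigma> \<and>
    (\<forall>\<tau><\<sigma>. Poly_Mapping.lookup g \<tau> = Poly_Mapping.lookup h \<tau>))"
  by (simp add: less_poly_mapping.rep_eq less_fun_def)

lemma value_grp_lessI:
  fixes g h :: value_grp
  assumes "Poly_Mapping.lookup g \<sigma> < Poly_Mapping.lookup h \<sigma>"
    and "\<And>\<tau>. \<tau> < \<sigma> \<Longrightarrow> Poly_Mapping.lookup g \<tau> = Poly_Mapping.lookup h \<tau>"
  shows "g < h"
  using assms unfolding value_grp_less_iff by blast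

abbreviation unit_value :: "omega1 \<Rightarrow> value_grp" where
  "unit_value \<sigma> \<equiv> Poly_Mapping.single \<sigma> 1"

lemma unit_value_less: "\<sigma> < \<tau> \<Longrightarrow> unit_value \<tau> < unit_value \<sigma>"
  by (rule value_grp_lessI[of _ \<sigma>]) (auto simp: lookup_single when_def)

lemma unit_value_pos: "0 < unit_value \<sigma>"
  by (rule value_grp_lessI[of _ \<sigma>]) (auto simp: lookup_single when_def)

lemma exists_bounded_strict_mono:
  obtains \<gamma> :: "nat \<Rightarrow> value_grp" and g where "strict_mono \<gamma>" "\<And>n. 0 \<le> \<gamma> n" "\<And>n. \<gamma> n < g"
proof -
  obtain \<sigma> \<tau> :: omega1 where "\<sigma> < \<tau>"
    using countable_omega1_strict_lower_bound[of "{undefined}"]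
    by (metis countable_insert countable_empty insertI1)
  define \<gamma> where "\<gamma> n = Poly_Mapping.single \<tau> (int n)" for n
  have "\<gamma> m < \<gamma> n" if "m < n" for m n
    using that by (intro value_grp_lessI[of _ \<tau>]) (auto simp: \<gamma>_def lookup_single when_def)
  then have "strict_mono \<gamma>" by (rule strict_monoI)
  moreover have "\<gamma> 0 = 0" by (simp add: \<gamma>_def)
  then have "0 \<le> \<gamma> n" for n using strict_mono_less_eq[OF \<open>strict_mono \<gamma>\<close>, of 0 n] by simp
  moreover have "\<gamma> n < unit_value \<sigma>" for n
    using \<open>\<sigma> < \<tau>\<close> by (intro value_grp_lessI[of _ \<sigma>]) (auto simp: \<gamma>_def lookup_single when_def)
  ultimately show thesis by (rule that)
qed

definition level :: "omega1 \<Rightarrow> value_grp set" where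
  "level \<sigma> = {g. \<forall>\<tau>\<le>\<sigma>. Poly_Mapping.lookup g \<tau> = 0}"

lemma exists_level:
  obtains \<sigma> where "g \<in> level \<sigma>"
proof -
  have "countable (Poly_Mapping.keys g)" by (simp add: countable_finite)
  then obtain \<sigma> where "\<And>\<tau>. \<tau> \<in> Poly_Mapping.keys g \<Longrightarrow> \<sigma> < \<tau>"
    by (rule countable_omega1_strict_lower_bound) blast
  then have "g \<in> level \<sigma>" by (force simp: level_def in_keys_iff)
  then show thesis by (rule that)
qed

lemma level_less_unit_value: "g \<in> level \<sigma> \<Longrightarrow> g < unit_value \<sigma>"
  by (rule value_grp_lessI[of _ \<sigma>]) (auto simp: level_def lookup_single when_def)

lemma level_less:
  assumes "g \<in> level \<sigma>" "h \<notin> level \<sigma>" "0 < h"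
  shows "g < h"
proof -
  obtain \<tau> where \<tau>: "0 < Poly_Mapping.lookup h \<tau>" "\<And>\<upsilon>. \<upsilon> < \<tau> \<Longrightarrow> Poly_Mapping.lookup h \<upsilon> = 0"
    using assms(3) unfolding value_grp_less_iff by auto
  then have "\<tau> \<le> \<sigma>" using assms(2) by (force simp: level_def)
  then show ?thesis using assms(1) \<tau> by (intro value_grp_lessI[of _ \<tau>]) (auto simp: level_def)
qed

lemma convex_subgroup_level: "convex_subgroup (level \<sigma>)"
proof -
  have "h \<in> level \<sigma>" if "g \<in> level \<sigma>" "0 \<le> h" "h \<le> g" for g h
  proof (cases "h = 0")
    case True
    then show ?thesis by (simp add: level_def)
  next
    case False
    then have "\<not> g < h" "0 < h" using that by auto
    then show ?thesis using level_less that(1) by blast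
  qed
  then show ?thesis by (auto simp: convex_subgroup_def level_def lookup_minus)
qed

lemma countable_level: "countable (level \<sigma>)"
proof -
  have "\<sigma> < \<tau>" if "g \<in> level \<sigma>" "Poly_Mapping.lookup g \<tau> \<noteq> 0" for g \<tau>
    using that by (force simp: level_def)
  then have "Poly_Mapping.lookup ` level \<sigma> \<subseteq> finite_support_functions 0 {\<sigma><..} UNIV"
    by (auto simp: finite_support_functions_def finite_lookup)
  moreover have "countable (finite_support_functions 0 {\<sigma><..} (UNIV :: int set))"
    by (intro countable_finite_support_functions countable_omega1_greaterThan countableI_type)
  ultimately have "countable (Poly_Mapping.lookup ` level \<sigma>)" by (rule countable_subset)
  then show ?thesis by (rule countable_image_inj_on) (simp add: inj_on_def lookup_inject)
qed

lemma value_grp_ordLeq_aleph1: "|UNIV :: value_grp set| \<le>o aleph1"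
proof -
  have "|UNIV :: value_grp set| \<le>o |finite_support_functions 0 (UNIV :: omega1 set) (UNIV :: int set)|"
    by (rule card_of_ordLeqI[of Poly_Mapping.lookup])
      (auto simp: inj_on_def lookup_inject finite_support_functions_def finite_lookup)
  moreover have "|finite_support_functions 0 (UNIV :: omega1 set) (UNIV :: int set)| \<le>o aleph1"
    by (intro finite_support_functions_Cinfinite_bound ordIso_imp_ordLeq[OF card_of_omega1]
        countable_Cinfinite_bound countableI_type Cinfinite_aleph1)
  ultimately show ?thesis by (rule ordLeq_transitive)
qed

section \<open>Well-ordered subsets of ordered groups\<close>

lemma lift_Suc_antimono_less:
  fixes s :: "nat \<Rightarrow> 'a::order"
  assumes "\<And>n. s (Suc n) < s n" "m < n"
  shows "s n < s m"
  using assms(2) by (induction rule: less_Suc_induct) (auto intro: assms(1) less_trans)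

lemma wfp_on_less_iff_not_descending:
  "wfp_on S ((<) :: 'a::linorder \<Rightarrow> 'a \<Rightarrow> bool) \<longleftrightarrow> (\<forall>s. range s \<subseteq> S \<longrightarrow> (\<exists>n::nat. s n \<le> s (Suc n)))"
  (is "_ \<longleftrightarrow> ?rhs")
proof
  assume wf: "wfp_on S (<)"
  show ?rhs
  proof (intro allI impI)
    fix s :: "nat \<Rightarrow> 'a"
    assume "range s \<subseteq> S"
    then have "\<exists>z\<in>range s. \<forall>y<z. y \<notin> range s"
      using wf unfolding wfp_on_iff_ex_minimal by (metis UNIV_not_empty image_is_empty)
    then show "\<exists>n. s n \<le> s (Suc n)" by (auto simp: not_less[symmetric])
  qed
next
  assume seq: ?rhs
  show "wfp_on S (<)"
    unfolding wfp_on_iff_ex_minimal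
  proof (intro allI impI, rule ccontr)
    fix B assume B: "B \<subseteq> S" "B \<noteq> {}" "\<not> (\<exists>z\<in>B. \<forall>y<z. y \<notin> B)"
    then have "\<exists>s. \<forall>n::nat. s n \<in> B \<and> s (Suc n) < s n"
      by (intro dependent_nat_choice) auto
    then show False using B(1) seq by (meson image_subsetI not_le subsetD)
  qed
qed

lemma wfp_on_less_incseq_subseq:
  fixes s :: "nat \<Rightarrow> 'a::linorder"
  assumes "wfp_on S (<)" "range s \<subseteq> S"
  obtains \<phi> :: "nat \<Rightarrow> nat" where "strict_mono \<phi>" "incseq (s \<circ> \<phi>)"
proof -
  obtain \<phi> :: "nat \<Rightarrow> nat" where \<phi>: "strict_mono \<phi>" "monoseq (\<lambda>n. s (\<phi> n))"
    using seq_monosub by blast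
  then consider "incseq (s \<circ> \<phi>)" | "decseq (s \<circ> \<phi>)"
    by (auto simp: monoseq_iff comp_def)
  then show thesis
  proof cases
    case 2
    have "range (s \<circ> \<phi>) \<subseteq> S" "range (s \<circ> \<phi>) \<noteq> {}" using assms(2) by auto
    then have "\<exists>z\<in>range (s \<circ> \<phi>). \<forall>y<z. y \<notin> range (s \<circ> \<phi>)"
      using assms(1) unfolding wfp_on_iff_ex_minimal by blast
    then obtain N where N: "\<And>n. s (\<phi> N) \<le> s (\<phi> n)" by (auto simp: not_less[symmetric])
    then have "s (\<phi> (n + N)) = s (\<phi> N)" for n
      using decseqD[OF 2, of N "n + N"] by (simp add: antisym)
    moreover have "strict_mono (\<lambda>n. \<phi> (n + N))"
      using \<phi>(1) by (simp add: strict_mono_def)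
    ultimately show thesis by (intro that[of "\<lambda>n. \<phi> (n + N)"]) (simp_all add: incseq_def)
  qed (use \<phi> that in blast)
qed

lemma wfp_on_less_finite: "finite S \<Longrightarrow> wfp_on S ((<) :: 'a::linorder \<Rightarrow> 'a \<Rightarrow> bool)"
  by (rule strict_partial_order_wfp_on_finite_set) auto

lemma wfp_on_less_range_strict_mono:
  fixes s :: "nat \<Rightarrow> 'a::linorder"
  shows "strict_mono s \<Longrightarrow> wfp_on (range s) (<)"
  by (simp add: wfp_on_image strict_mono_less)

lemma wfp_on_less_Un:
  fixes S T :: "'a::linorder set"
  assumes "wfp_on S (<)" "wfp_on T (<)"
  shows "wfp_on (S \<union> T) (<)"
proof -
  have "\<exists>z\<in>U. \<forall>y<z. y \<notin> U" if U: "U \<subseteq> S \<union> T" "U \<noteq> {}" for U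
  proof (cases "U \<inter> S = {}")
    case True
    then have "U \<subseteq> T" using U(1) by blast
    then show ?thesis using U(2) assms(2) unfolding wfp_on_iff_ex_minimal by blast
  next
    case False
    then obtain m where m: "m \<in> U" "\<forall>y<m. y \<notin> U \<inter> S"
      using assms(1) unfolding wfp_on_iff_ex_minimal by (metis Int_iff inf_le2)
    show ?thesis
    proof (cases "\<exists>y<m. y \<in> U")
      case True
      then have "{y \<in> U. y < m} \<subseteq> T" "{y \<in> U. y < m} \<noteq> {}" using U m by auto
      then obtain z where "z \<in> U" "z < m" "\<forall>y<z. y \<notin> {y \<in> U. y < m}"
        using assms(2) unfolding wfp_on_iff_ex_minimal
        by (metis (mono_tags, lifting) mem_Collect_eq)
      then show ?thesis by (metis (mono_tags, lifting) less_trans mem_Collect_eq)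
    qed (use m in blast)
  qed
  then show ?thesis unfolding wfp_on_iff_ex_minimal by blast
qed

lemma finite_wfp_on_less_fibre:
  fixes S T :: "'a::linordered_ab_group_add set"
  assumes "wfp_on S (<)" "wfp_on T (<)"
  shows "finite {a \<in> S. g - a \<in> T}"
proof (rule ccontr)
  assume "infinite {a \<in> S. g - a \<in> T}"
  then obtain s :: "nat \<Rightarrow> 'a" where s: "inj s" "range s \<subseteq> {a \<in> S. g - a \<in> T}"
    using infinite_countable_subset by blast
  then obtain \<phi> :: "nat \<Rightarrow> nat" where \<phi>: "strict_mono \<phi>" "incseq (s \<circ> \<phi>)"
    using wfp_on_less_incseq_subseq[OF assms(1), of s] by blast
  have "range (\<lambda>n. g - s (\<phi> n)) \<subseteq> T" using s(2) by blast
  then obtain n where "g - s (\<phi> n) \<le> g - s (\<phi> (Suc n))"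
    using assms(2) unfolding wfp_on_less_iff_not_descending by blast
  moreover have "s (\<phi> n) \<le> s (\<phi> (Suc n))" using incseq_SucD[OF \<phi>(2), of n] by simp
  ultimately have "\<phi> n = \<phi> (Suc n)" using s(1) by (simp add: inj_eq)
  then show False using \<phi>(1) by (simp add: strict_mono_eq)
qed

lemma wfp_on_less_set_plus:
  fixes S T :: "'a::linordered_ab_group_add set"
  assumes "wfp_on S (<)" "wfp_on T (<)"
  shows "wfp_on (S + T) (<)"
  unfolding wfp_on_less_iff_not_descending
proof (intro allI impI, rule ccontr)
  fix s :: "nat \<Rightarrow> 'a"
  assume s: "range s \<subseteq> S + T" and "\<nexists>n. s n \<le> s (Suc n)"
  then have desc: "s (Suc n) < s n" for n by (meson not_le)
  have "\<forall>n. \<exists>a b. s n = a + b \<and> a \<in> S \<and> b \<in> T"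
    using s by (metis rangeI set_plus_elim subsetD)
  then obtain a b where ab: "\<And>n. s n = a n + b n" "range a \<subseteq> S" "range b \<subseteq> T"
    by (metis image_subsetI)
  obtain \<phi> :: "nat \<Rightarrow> nat" where \<phi>: "strict_mono \<phi>" "incseq (a \<circ> \<phi>)"
    using wfp_on_less_incseq_subseq[OF assms(1) ab(2)] .
  have "range (b \<circ> \<phi>) \<subseteq> T" using ab(3) by auto
  then obtain n where "b (\<phi> n) \<le> b (\<phi> (Suc n))"
    using assms(2) unfolding wfp_on_less_iff_not_descending by fastforce
  then have "s (\<phi> n) \<le> s (\<phi> (Suc n))"
    using incseq_SucD[OF \<phi>(2), of n] by (simp add: ab(1) add_mono)
  moreover have "s (\<phi> (Suc n)) < s (\<phi> n)"
    using \<phi>(1) by (simp add: lift_Suc_antimono_less[of s, OF desc] strict_mono_less)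
  ultimately show False by simp
qed

lemma minimal_descending_sequence:
  fixes v :: "'b \<Rightarrow> 'a::linorder" and len :: "'b \<Rightarrow> nat"
  assumes "\<not> wfp_on (v ` A) (<)"
  obtains f :: "nat \<Rightarrow> 'b" where "range f \<subseteq> A" "\<And>n. v (f (Suc n)) < v (f n)"
    and "\<And>r n. range r \<subseteq> A \<Longrightarrow> (\<And>k. v (r (Suc k)) < v (r k)) \<Longrightarrow>
        v (r 0) < v (f n) \<Longrightarrow> len (f (Suc n)) \<le> len (r 0)"
proof -
  define descends where "descends x \<longleftrightarrow>
    (\<exists>r. r 0 = x \<and> range r \<subseteq> A \<and> (\<forall>k::nat. v (r (Suc k)) < v (r k)))" for x
  have next_minimal: "\<exists>y. descends y \<and> v y < v x \<and> (\<forall>z. descends z \<and> v z < v x \<longrightarrow> len y \<le> len z)"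
    if "descends x" for x
  proof -
    obtain r :: "nat \<Rightarrow> 'b" where r: "r 0 = x" "range r \<subseteq> A" "\<And>k. v (r (Suc k)) < v (r k)"
      using \<open>descends x\<close> unfolding descends_def by blast
    have "descends (r 1)"
      unfolding descends_def using r by (intro exI[of _ "\<lambda>k. r (Suc k)"]) auto
    then have "descends (r 1) \<and> v (r 1) < v x" using r(1) r(3)[of 0] by simp
    then show ?thesis using ex_has_least_nat[of "\<lambda>y. descends y \<and> v y < v x" "r 1" len] by blast
  qed
  obtain s :: "nat \<Rightarrow> 'a" where s: "range s \<subseteq> v ` A" "\<And>n. s (Suc n) < s n"
    using assms unfolding wfp_on_less_iff_not_descending by (meson not_le)
  then have "\<forall>n. \<exists>x. x \<in> A \<and> s n = v x" by auto
  then obtain r where "\<And>n. r n \<in> A" "\<And>n. s n = v (r n)" by metis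
  then have "descends (r 0)" using s(2) unfolding descends_def by (intro exI[of _ r]) auto
  then have "\<exists>f. \<forall>n::nat. descends (f n) \<and> v (f (Suc n)) < v (f n) \<and>
      (\<forall>z. descends z \<and> v z < v (f n) \<longrightarrow> len (f (Suc n)) \<le> len z)"
    using next_minimal by (intro dependent_nat_choice) blast+
  then obtain f where f: "\<And>n. descends (f n)" "\<And>n. v (f (Suc n)) < v (f n)"
    "\<And>n z. descends z \<Longrightarrow> v z < v (f n) \<Longrightarrow> len (f (Suc n)) \<le> len z"
    by blast
  show thesis
  proof (rule that[of f])
    have "f n \<in> A" for n using f(1)[of n] unfolding descends_def by (metis rangeI subsetD)
    then show "range f \<subseteq> A" by blast
    show "len (f (Suc n)) \<le> len (r 0)"
      if "range r \<subseteq> A" "\<And>k. v (r (Suc k)) < v (r k)" "v (r 0) < v (f n)" for r n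
    proof (rule f(3)[OF _ that(3)])
      show "descends (r 0)" unfolding descends_def using that(1,2) by (intro exI[of _ r]) simp
    qed
  qed (rule f(2))
qed

text \<open>Neumann's lemma. In a descending sequence of sums with as few summands as possible, cancelling
  the first summands along a subsequence on which they increase leaves a descending sequence of
  shorter sums.\<close>

lemma wfp_on_less_sum_list:
  fixes S :: "'a::linordered_ab_group_add set"
  assumes wf: "wfp_on S (<)" and pos: "\<And>a. a \<in> S \<Longrightarrow> 0 < a"
  shows "wfp_on (sum_list ` lists S) (<)"
proof (rule ccontr)
  assume "\<not> ?thesis"
  then obtain f :: "nat \<Rightarrow> 'a list"
    where f: "range f \<subseteq> lists S" "\<And>n. sum_list (f (Suc n)) < sum_list (f n)"
    and minimal: "\<And>r n. range r \<subseteq> lists S \<Longrightarrow> (\<And>k. sum_list (r (Suc k)) < sum_list (r k)) \<Longrightarrow>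
      sum_list (r 0) < sum_list (f n) \<Longrightarrow> length (f (Suc n)) \<le> length (r 0)"
    using minimal_descending_sequence[where len = length] by metis
  have "f n \<noteq> []" for n
  proof
    assume "f n = []"
    moreover have "0 \<le> sum_list (f (Suc n))"
      using f(1) pos by (intro sum_list_nonneg less_imp_le) blast
    ultimately show False using f(2)[of n] by simp
  qed
  then have "\<forall>n. \<exists>a as. f (Suc n) = a # as" by (metis neq_Nil_conv)
  then obtain a as where Cons: "\<And>n. f (Suc n) = a n # as n" by metis
  have "f (Suc n) \<in> lists S" for n using f(1) by blast
  then have aS: "range a \<subseteq> S" and as: "range as \<subseteq> lists S" by (auto simp: Cons)
  obtain \<phi> :: "nat \<Rightarrow> nat" where \<phi>: "strict_mono \<phi>" "incseq (a \<circ> \<phi>)"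
    using wfp_on_less_incseq_subseq[OF wf aS] .
  have "sum_list (as (\<phi> (Suc n))) < sum_list (as (\<phi> n))" for n
  proof -
    have "sum_list (f (Suc (\<phi> (Suc n)))) < sum_list (f (Suc (\<phi> n)))"
      using \<phi>(1) by (simp add: lift_Suc_antimono_less[of "\<lambda>n. sum_list (f n)",
        OF f(2)] strict_mono_less)
    also have "sum_list (f (Suc (\<phi> n))) \<le> a (\<phi> (Suc n)) + sum_list (as (\<phi> n))"
      using incseq_SucD[OF \<phi>(2), of n] by (simp add: Cons)
    finally show ?thesis by (simp add: Cons)
  qed
  moreover have "sum_list (as (\<phi> 0)) < sum_list (f (\<phi> 0))"
  proof -
    have "sum_list (as (\<phi> 0)) < sum_list (f (Suc (\<phi> 0)))"
      using pos aS by (simp add: Cons image_subset_iff)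
    then show ?thesis using f(2) less_trans by blast
  qed
  ultimately have "length (f (Suc (\<phi> 0))) \<le> length (as (\<phi> 0))"
    using minimal[of "as \<circ> \<phi>" "\<phi> 0"] as by auto
  then show False by (simp add: Cons)
qed

section \<open>Hahn series\<close>

definition hahn_ring :: "('k, 'e) ring_scheme \<Rightarrow> ('g::linordered_ab_group_add \<Rightarrow> 'k) ring" where
  "hahn_ring K =
     \<lparr> carrier = {f. range f \<subseteq> carrier K \<and> wfp_on {g. f g \<noteq> \<zero>\<^bsub>K\<^esub>} (<)},
       monoid.mult = (\<lambda>f h g. \<Oplus>\<^bsub>K\<^esub>a\<in>{a. f a \<noteq> \<zero>\<^bsub>K\<^esub> \<and> h (g - a) \<noteq> \<zero>\<^bsub>K\<^esub>}. f a \<otimes>\<^bsub>K\<^esub> h (g - a)),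
       monoid.one = (\<lambda>g. if g = 0 then \<one>\<^bsub>K\<^esub> else \<zero>\<^bsub>K\<^esub>),
       ring.zero = (\<lambda>g. \<zero>\<^bsub>K\<^esub>),
       ring.add = (\<lambda>f h g. f g \<oplus>\<^bsub>K\<^esub> h g) \<rparr>"

lemma (in abelian_monoid) finsum_swap:
  assumes "finite A" "finite B" "\<And>a b. a \<in> A \<Longrightarrow> b \<in> B \<Longrightarrow> F a b \<in> carrier G"
  shows "(\<Oplus>a\<in>A. \<Oplus>b\<in>B. F a b) = (\<Oplus>b\<in>B. \<Oplus>a\<in>A. F a b)"
  using assms(1,3)
proof (induction A rule: finite_induct)
  case empty
  then show ?case by (simp add: finsum_zero)
next
  case (insert x A)
  have "(\<Oplus>a\<in>insert x A. \<Oplus>b\<in>B. F a b) = (\<Oplus>b\<in>B. F x b) \<oplus> (\<Oplus>b\<in>B. \<Oplus>a\<in>A. F a b)"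
    using insert by (subst finsum_insert) (auto intro!: finsum_closed)
  also have "\<dots> = (\<Oplus>b\<in>B. F x b \<oplus> (\<Oplus>a\<in>A. F a b))"
    using insert by (intro finsum_addf[symmetric]) (auto intro!: finsum_closed)
  also have "\<dots> = (\<Oplus>b\<in>B. \<Oplus>a\<in>insert x A. F a b)"
    using insert by (intro finsum_cong') (auto intro!: finsum_closed finsum_insert[symmetric])
  finally show ?case .
qed

context cring
begin

abbreviation hahn :: "('g::linordered_ab_group_add \<Rightarrow> 'a) ring" where
  "hahn \<equiv> hahn_ring R"

abbreviation supp :: "('g \<Rightarrow> 'a) \<Rightarrow> 'g set" where
  "supp f \<equiv> {g. f g \<noteq> \<zero>}"

lemma hahn_carrier_iff: "f \<in> carrier hahn \<longleftrightarrow> range f \<subseteq> carrier R \<and> wfp_on (supp f) (<)"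
  and hahn_one: "\<one>\<^bsub>hahn\<^esub> = (\<lambda>g. if g = 0 then \<one> else \<zero>)"
  and hahn_zero: "\<zero>\<^bsub>hahn\<^esub> = (\<lambda>g. \<zero>)"
  and hahn_add: "f \<oplus>\<^bsub>hahn\<^esub> h = (\<lambda>g. f g \<oplus> h g)"
  by (simp_all add: hahn_ring_def)

lemma hahn_coeff_closed: "f \<in> carrier hahn \<Longrightarrow> f g \<in> carrier R"
  by (auto simp: hahn_carrier_iff)

lemma finite_hahn_mult_support:
  assumes "f \<in> carrier hahn" "h \<in> carrier hahn"
  shows "finite {a. f a \<noteq> \<zero> \<and> h (g - a) \<noteq> \<zero>}"
  using finite_wfp_on_less_fibre[of "supp f" "supp h" g] assms by (simp add: hahn_carrier_iff)

lemma hahn_mult_eq_finsum: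
  assumes "f \<in> carrier hahn" "h \<in> carrier hahn"
    and "finite A" "\<And>a. f a \<noteq> \<zero> \<Longrightarrow> h (g - a) \<noteq> \<zero> \<Longrightarrow> a \<in> A"
  shows "(f \<otimes>\<^bsub>hahn\<^esub> h) g = (\<Oplus>a\<in>A. f a \<otimes> h (g - a))"
proof -
  have "(f \<otimes>\<^bsub>hahn\<^esub> h) g = (\<Oplus>a\<in>{a. f a \<noteq> \<zero> \<and> h (g - a) \<noteq> \<zero>}. f a \<otimes> h (g - a))"
    by (simp add: hahn_ring_def)
  also have "\<dots> = (\<Oplus>a\<in>A. f a \<otimes> h (g - a))"
    by (rule add.finprod_mono_neutral_cong_left)
      (use assms hahn_coeff_closed[OF assms(1)] hahn_coeff_closed[OF assms(2)] in auto)
  finally show ?thesis .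
qed

lemma supp_hahn_mult_subset: "supp (f \<otimes>\<^bsub>hahn\<^esub> h) \<subseteq> supp f + supp h"
proof
  fix g assume "g \<in> supp (f \<otimes>\<^bsub>hahn\<^esub> h)"
  then have "{a. f a \<noteq> \<zero> \<and> h (g - a) \<noteq> \<zero>} \<noteq> {}" by (intro notI) (simp add: hahn_ring_def)
  then obtain a where "a \<in> supp f" "g - a \<in> supp h" by blast
  then have "a + (g - a) \<in> supp f + supp h" by (rule set_plus_intro)
  then show "g \<in> supp f + supp h" by simp
qed

lemma hahn_mult_closed:
  assumes "f \<in> carrier hahn" "h \<in> carrier hahn"
  shows "f \<otimes>\<^bsub>hahn\<^esub> h \<in> carrier hahn"
proof -
  have "(f \<otimes>\<^bsub>hahn\<^esub> h) g \<in> carrier R" for g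
    using hahn_coeff_closed[OF assms(1)] hahn_coeff_closed[OF assms(2)]
    by (auto simp: hahn_ring_def intro!: finsum_closed)
  moreover have "wfp_on (supp (f \<otimes>\<^bsub>hahn\<^esub> h)) (<)"
    using assms by (intro wfp_on_subset[OF wfp_on_less_set_plus supp_hahn_mult_subset])
      (simp_all add: hahn_carrier_iff)
  ultimately show ?thesis by (auto simp: hahn_carrier_iff)
qed

lemma hahn_mult_comm:
  assumes "f \<in> carrier hahn" "h \<in> carrier hahn"
  shows "f \<otimes>\<^bsub>hahn\<^esub> h = h \<otimes>\<^bsub>hahn\<^esub> f"
proof
  fix g
  note [simp] = hahn_coeff_closed[OF assms(1)] hahn_coeff_closed[OF assms(2)]
  let ?A = "{a. f a \<noteq> \<zero> \<and> h (g - a) \<noteq> \<zero>}"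
  have fin: "finite ?A" by (rule finite_hahn_mult_support[OF assms])
  have "(h \<otimes>\<^bsub>hahn\<^esub> f) g = (\<Oplus>b\<in>(\<lambda>a. g - a) ` ?A. h b \<otimes> f (g - b))"
    using assms fin by (intro hahn_mult_eq_finsum) (auto intro!: image_eqI[of _ _ "g - _"])
  also have "\<dots> = (\<Oplus>a\<in>?A. h (g - a) \<otimes> f (g - (g - a)))"
    by (rule finsum_reindex) (auto simp: inj_on_def)
  also have "\<dots> = (\<Oplus>a\<in>?A. f a \<otimes> h (g - a))"
    by (rule finsum_cong') (auto simp: m_comm)
  also have "\<dots> = (f \<otimes>\<^bsub>hahn\<^esub> h) g"
    using assms fin by (intro hahn_mult_eq_finsum[symmetric]) auto
  finally show "(f \<otimes>\<^bsub>hahn\<^esub> h) g = (h \<otimes>\<^bsub>hahn\<^esub> f) g" by simp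
qed

lemma hahn_mult_mult_eq_finsum:
  assumes f: "f \<in> carrier hahn" and h: "h \<in> carrier hahn" and k: "k \<in> carrier hahn"
    and "finite A" "finite B"
    and AB: "\<And>a b. f a \<noteq> \<zero> \<Longrightarrow> h b \<noteq> \<zero> \<Longrightarrow> k (g - a - b) \<noteq> \<zero> \<Longrightarrow> a \<in> A \<and> b \<in> B"
  shows "(f \<otimes>\<^bsub>hahn\<^esub> (h \<otimes>\<^bsub>hahn\<^esub> k)) g = (\<Oplus>a\<in>A. \<Oplus>b\<in>B. f a \<otimes> (h b \<otimes> k (g - a - b)))"
proof -
  note [simp] = hahn_coeff_closed[OF f] hahn_coeff_closed[OF h] hahn_coeff_closed[OF k]
    hahn_coeff_closed[OF hahn_mult_closed[OF h k]]
  have "(f \<otimes>\<^bsub>hahn\<^esub> (h \<otimes>\<^bsub>hahn\<^esub> k)) g = (\<Oplus>a\<in>A. f a \<otimes> (h \<otimes>\<^bsub>hahn\<^esub> k) (g - a))"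
  proof (rule hahn_mult_eq_finsum[OF f hahn_mult_closed[OF h k] \<open>finite A\<close>])
    fix a assume a: "f a \<noteq> \<zero>" "(h \<otimes>\<^bsub>hahn\<^esub> k) (g - a) \<noteq> \<zero>"
    then have "g - a \<in> supp h + supp k" using supp_hahn_mult_subset[of h k] by blast
    then obtain b c where "g - a = b + c" "h b \<noteq> \<zero>" "k c \<noteq> \<zero>" by (auto elim: set_plus_elim)
    then show "a \<in> A" using AB[of a b] a(1) by simp
  qed
  also have "\<dots> = (\<Oplus>a\<in>A. \<Oplus>b\<in>B. f a \<otimes> (h b \<otimes> k (g - a - b)))"
  proof (rule finsum_cong')
    fix a assume "a \<in> A"
    show "f a \<otimes> (h \<otimes>\<^bsub>hahn\<^esub> k) (g - a) = (\<Oplus>b\<in>B. f a \<otimes> (h b \<otimes> k (g - a - b)))"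
    proof (cases "f a = \<zero>")
      case False
      then have "(h \<otimes>\<^bsub>hahn\<^esub> k) (g - a) = (\<Oplus>b\<in>B. h b \<otimes> k (g - a - b))"
        using AB \<open>finite B\<close> by (intro hahn_mult_eq_finsum h k) auto
      then show ?thesis using \<open>finite B\<close> by (simp add: finsum_rdistr)
    qed (simp add: finsum_zero)
  qed (auto intro!: finsum_closed)
  finally show ?thesis .
qed

lemma hahn_mult_left_comm:
  assumes f: "f \<in> carrier hahn" and h: "h \<in> carrier hahn" and k: "k \<in> carrier hahn"
  shows "f \<otimes>\<^bsub>hahn\<^esub> (h \<otimes>\<^bsub>hahn\<^esub> k) = h \<otimes>\<^bsub>hahn\<^esub> (f \<otimes>\<^bsub>hahn\<^esub> k)"
proof
  fix g
  note [simp] = hahn_coeff_closed[OF f] hahn_coeff_closed[OF h] hahn_coeff_closed[OF k]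
  define A where "A = {a \<in> supp f. g - a \<in> supp h + supp k}"
  define B where "B = {b \<in> supp h. g - b \<in> supp f + supp k}"
  have fin: "finite A" "finite B"
    unfolding A_def B_def
    by (rule finite_wfp_on_less_fibre; use f h k in \<open>simp add: hahn_carrier_iff wfp_on_less_set_plus\<close>)+
  have sub_comm: "g - a - b = g - b - a" for a b by (simp add: algebra_simps)
  have AB: "a \<in> A \<and> b \<in> B" if "f a \<noteq> \<zero>" "h b \<noteq> \<zero>" "k (g - a - b) \<noteq> \<zero>" for a b
    using that set_plus_intro[of b "supp h" "g - a - b" "supp k"]
      set_plus_intro[of a "supp f" "g - a - b" "supp k"]
    by (auto simp: A_def B_def algebra_simps)
  have "(f \<otimes>\<^bsub>hahn\<^esub> (h \<otimes>\<^bsub>hahn\<^esub> k)) g = (\<Oplus>a\<in>A. \<Oplus>b\<in>B. f a \<otimes> (h b \<otimes> k (g - a - b)))"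
    by (rule hahn_mult_mult_eq_finsum[OF f h k fin AB])
  also have "\<dots> = (\<Oplus>b\<in>B. \<Oplus>a\<in>A. f a \<otimes> (h b \<otimes> k (g - a - b)))"
    by (rule finsum_swap) (simp_all add: fin)
  also have "\<dots> = (\<Oplus>b\<in>B. \<Oplus>a\<in>A. h b \<otimes> (f a \<otimes> k (g - b - a)))"
    by (simp add: m_lcomm sub_comm)
  also have "\<dots> = (h \<otimes>\<^bsub>hahn\<^esub> (f \<otimes>\<^bsub>hahn\<^esub> k)) g"
    using AB by (intro hahn_mult_mult_eq_finsum[symmetric] f h k fin) (metis sub_comm)
  finally show "(f \<otimes>\<^bsub>hahn\<^esub> (h \<otimes>\<^bsub>hahn\<^esub> k)) g = (h \<otimes>\<^bsub>hahn\<^esub> (f \<otimes>\<^bsub>hahn\<^esub> k)) g" .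
qed

lemma hahn_mult_assoc:
  assumes "f \<in> carrier hahn" "h \<in> carrier hahn" "k \<in> carrier hahn"
  shows "(f \<otimes>\<^bsub>hahn\<^esub> h) \<otimes>\<^bsub>hahn\<^esub> k = f \<otimes>\<^bsub>hahn\<^esub> (h \<otimes>\<^bsub>hahn\<^esub> k)"
  using assms by (metis hahn_mult_closed hahn_mult_comm hahn_mult_left_comm)

lemma hahn_distrib_right:
  assumes f: "f \<in> carrier hahn" and h: "h \<in> carrier hahn" and k: "k \<in> carrier hahn"
    and fh: "f \<oplus>\<^bsub>hahn\<^esub> h \<in> carrier hahn"
  shows "(f \<oplus>\<^bsub>hahn\<^esub> h) \<otimes>\<^bsub>hahn\<^esub> k = f \<otimes>\<^bsub>hahn\<^esub> k \<oplus>\<^bsub>hahn\<^esub> h \<otimes>\<^bsub>hahn\<^esub> k"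
proof
  fix g
  note [simp] = hahn_coeff_closed[OF f] hahn_coeff_closed[OF h] hahn_coeff_closed[OF k]
  define A where "A = {a. f a \<noteq> \<zero> \<and> k (g - a) \<noteq> \<zero>} \<union> {a. h a \<noteq> \<zero> \<and> k (g - a) \<noteq> \<zero>}"
  have fin: "finite A" unfolding A_def using finite_hahn_mult_support f h k by blast
  have "((f \<oplus>\<^bsub>hahn\<^esub> h) \<otimes>\<^bsub>hahn\<^esub> k) g = (\<Oplus>a\<in>A. (f \<oplus>\<^bsub>hahn\<^esub> h) a \<otimes> k (g - a))"
    by (rule hahn_mult_eq_finsum[OF fh k fin]) (auto simp: A_def hahn_add)
  also have "\<dots> = (\<Oplus>a\<in>A. f a \<otimes> k (g - a) \<oplus> h a \<otimes> k (g - a))"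
    by (simp add: hahn_add l_distr)
  also have "\<dots> = (\<Oplus>a\<in>A. f a \<otimes> k (g - a)) \<oplus> (\<Oplus>a\<in>A. h a \<otimes> k (g - a))"
    by (rule finsum_addf) auto
  also have "(\<Oplus>a\<in>A. f a \<otimes> k (g - a)) = (f \<otimes>\<^bsub>hahn\<^esub> k) g"
    by (rule hahn_mult_eq_finsum[OF f k fin, symmetric]) (simp add: A_def)
  also have "(\<Oplus>a\<in>A. h a \<otimes> k (g - a)) = (h \<otimes>\<^bsub>hahn\<^esub> k) g"
    by (rule hahn_mult_eq_finsum[OF h k fin, symmetric]) (simp add: A_def)
  finally show "((f \<oplus>\<^bsub>hahn\<^esub> h) \<otimes>\<^bsub>hahn\<^esub> k) g = (f \<otimes>\<^bsub>hahn\<^esub> k \<oplus>\<^bsub>hahn\<^esub> h \<otimes>\<^bsub>hahn\<^esub> k) g"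
    by (simp add: hahn_add)
qed

definition monom_series :: "'a \<Rightarrow> 'g \<Rightarrow> 'g::linordered_ab_group_add \<Rightarrow> 'a" where
  "monom_series c g = (\<lambda>x. if x = g then c else \<zero>)"

lemma monom_series_closed: "c \<in> carrier R \<Longrightarrow> monom_series c g \<in> carrier hahn"
  by (auto simp: hahn_carrier_iff monom_series_def intro!: wfp_on_less_finite)

lemma monom_series_mult_coeff:
  assumes "c \<in> carrier R" "f \<in> carrier hahn"
  shows "(monom_series c g \<otimes>\<^bsub>hahn\<^esub> f) x = c \<otimes> f (x - g)"
proof -
  have "(monom_series c g \<otimes>\<^bsub>hahn\<^esub> f) x = (\<Oplus>a\<in>{g}. monom_series c g a \<otimes> f (x - a))"
    using assms by (intro hahn_mult_eq_finsum monom_series_closed)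
      (auto simp: monom_series_def split: if_splits)
  then show ?thesis
    using assms hahn_coeff_closed[OF assms(2)] by (simp add: monom_series_def)
qed

lemma hahn_one_eq_monom_series: "\<one>\<^bsub>hahn\<^esub> = monom_series \<one> 0"
  by (simp add: hahn_one monom_series_def)

lemma uminus_coeff_closed: "f \<in> carrier hahn \<Longrightarrow> (\<lambda>g. \<ominus> f g) \<in> carrier hahn"
  by (auto simp: hahn_carrier_iff elim!: wfp_on_subset)

lemma hahn_abelian_group: "abelian_group (hahn :: ('g::linordered_ab_group_add \<Rightarrow> 'a) ring)"
proof (rule abelian_groupI)
  fix f h k :: "'g \<Rightarrow> 'a"
  assume f: "f \<in> carrier hahn" and h: "h \<in> carrier hahn"
  note [simp] = hahn_coeff_closed[OF f] hahn_coeff_closed[OF h]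
  have "wfp_on (supp (\<lambda>g. f g \<oplus> h g)) (<)"
    by (rule wfp_on_subset[OF wfp_on_less_Un[of "supp f" "supp h"]])
      (use f h in \<open>auto simp: hahn_carrier_iff\<close>)
  then show "f \<oplus>\<^bsub>hahn\<^esub> h \<in> carrier hahn" by (auto simp: hahn_carrier_iff hahn_add)
  show "f \<oplus>\<^bsub>hahn\<^esub> h = h \<oplus>\<^bsub>hahn\<^esub> f" by (auto simp: hahn_add a_comm)
  show "f \<oplus>\<^bsub>hahn\<^esub> h \<oplus>\<^bsub>hahn\<^esub> k = f \<oplus>\<^bsub>hahn\<^esub> (h \<oplus>\<^bsub>hahn\<^esub> k)" if "k \<in> carrier hahn"
    using hahn_coeff_closed[OF that] by (simp add: hahn_add a_assoc)
next
  fix f :: "'g \<Rightarrow> 'a"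
  assume f: "f \<in> carrier hahn"
  show "\<zero>\<^bsub>hahn\<^esub> \<oplus>\<^bsub>hahn\<^esub> f = f" using hahn_coeff_closed[OF f] by (simp add: hahn_add hahn_zero)
  show "\<exists>h\<in>carrier hahn. h \<oplus>\<^bsub>hahn\<^esub> f = \<zero>\<^bsub>hahn\<^esub>"
    using uminus_coeff_closed[OF f] hahn_coeff_closed[OF f]
    by (intro bexI[of _ "\<lambda>g. \<ominus> f g"]) (simp_all add: hahn_add hahn_zero l_neg)
qed (auto simp: hahn_carrier_iff hahn_zero wfp_on_less_finite)

lemma hahn_cring: "cring (hahn :: ('g::linordered_ab_group_add \<Rightarrow> 'a) ring)"
proof (rule cringI[OF hahn_abelian_group])
  interpret H: abelian_group "hahn :: ('g \<Rightarrow> 'a) ring" by (rule hahn_abelian_group)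
  show "comm_monoid (hahn :: ('g \<Rightarrow> 'a) ring)"
  proof (rule comm_monoidI)
    fix f :: "'g \<Rightarrow> 'a" assume f: "f \<in> carrier hahn"
    show "\<one>\<^bsub>hahn\<^esub> \<otimes>\<^bsub>hahn\<^esub> f = f"
      unfolding hahn_one_eq_monom_series
      using f hahn_coeff_closed[OF f] by (simp add: fun_eq_iff monom_series_mult_coeff)
  qed (use hahn_mult_closed hahn_mult_assoc hahn_mult_comm in
      \<open>auto simp: hahn_one_eq_monom_series monom_series_closed\<close>)
  show "(f \<oplus>\<^bsub>hahn\<^esub> h) \<otimes>\<^bsub>hahn\<^esub> k = f \<otimes>\<^bsub>hahn\<^esub> k \<oplus>\<^bsub>hahn\<^esub> h \<otimes>\<^bsub>hahn\<^esub> k"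
    if "f \<in> carrier hahn" "h \<in> carrier hahn" "k \<in> carrier hahn" for f h k :: "'g \<Rightarrow> 'a"
    using that by (intro hahn_distrib_right H.a_closed)
qed

lemma hahn_a_inv:
  fixes f :: "'g::linordered_ab_group_add \<Rightarrow> 'a"
  assumes f: "f \<in> carrier hahn"
  shows "\<ominus>\<^bsub>hahn\<^esub> f = (\<lambda>g. \<ominus> f g)"
proof -
  interpret H: cring "hahn :: ('g \<Rightarrow> 'a) ring" by (rule hahn_cring)
  have "(\<lambda>g. \<ominus> f g) \<oplus>\<^bsub>hahn\<^esub> f = \<zero>\<^bsub>hahn\<^esub>"
    using hahn_coeff_closed[OF f] by (simp add: hahn_add hahn_zero l_neg)
  then show ?thesis using f by (intro H.minus_equality uminus_coeff_closed)
qed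

lemma hahn_mult_bounded_below:
  assumes "(f \<otimes>\<^bsub>hahn\<^esub> h) g \<noteq> \<zero>" "\<And>a. f a \<noteq> \<zero> \<Longrightarrow> \<alpha> \<le> a" "\<And>b. h b \<noteq> \<zero> \<Longrightarrow> \<beta> \<le> b"
  shows "\<alpha> + \<beta> \<le> g"
proof -
  have "g \<in> supp f + supp h" using assms(1) supp_hahn_mult_subset by blast
  then show ?thesis using assms(2,3) by (auto elim!: set_plus_elim intro!: add_mono)
qed

lemma hahn_mult_lowest_coeff:
  assumes "f \<in> carrier hahn" "h \<in> carrier hahn"
    and "\<And>a. f a \<noteq> \<zero> \<Longrightarrow> \<alpha> \<le> a" "\<And>b. h b \<noteq> \<zero> \<Longrightarrow> \<beta> \<le> b"
  shows "(f \<otimes>\<^bsub>hahn\<^esub> h) (\<alpha> + \<beta>) = f \<alpha> \<otimes> h \<beta>"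
proof -
  have "a = \<alpha>" if "f a \<noteq> \<zero>" "h (\<alpha> + \<beta> - a) \<noteq> \<zero>" for a
    using assms(3)[OF that(1)] assms(4)[OF that(2)] by (simp add: le_diff_eq)
  then have "(f \<otimes>\<^bsub>hahn\<^esub> h) (\<alpha> + \<beta>) = (\<Oplus>a\<in>{\<alpha>}. f a \<otimes> h (\<alpha> + \<beta> - a))"
    by (intro hahn_mult_eq_finsum assms(1,2)) auto
  then show ?thesis
    using hahn_coeff_closed[OF assms(1)] hahn_coeff_closed[OF assms(2)] by simp
qed

definition hahn_val :: "('g::linordered_ab_group_add \<Rightarrow> 'a) \<Rightarrow> 'g" where
  "hahn_val f = (LEAST g. f g \<noteq> \<zero>)"

lemma hahn_val_least:
  assumes f: "f \<in> carrier hahn" "f \<noteq> \<zero>\<^bsub>hahn\<^esub>"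
  shows "f (hahn_val f) \<noteq> \<zero> \<and> (\<forall>g. f g \<noteq> \<zero> \<longrightarrow> hahn_val f \<le> g)"
proof -
  have "wfp_on (supp f) (<)" "supp f \<noteq> {}" using f by (auto simp: hahn_carrier_iff hahn_zero)
  then have "\<exists>m\<in>supp f. \<forall>y<m. y \<notin> supp f" unfolding wfp_on_iff_ex_minimal by blast
  then obtain m where m: "f m \<noteq> \<zero>" "\<And>g. f g \<noteq> \<zero> \<Longrightarrow> m \<le> g" by (auto simp: not_less[symmetric])
  then have "hahn_val f = m" unfolding hahn_val_def by (rule Least_equality)
  then show ?thesis using m by blast
qed

lemma hahn_val_coeff_nonzero: "f \<in> carrier hahn \<Longrightarrow> f \<noteq> \<zero>\<^bsub>hahn\<^esub> \<Longrightarrow> f (hahn_val f) \<noteq> \<zero>"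
  using hahn_val_least by blast

lemma hahn_val_le: "f \<in> carrier hahn \<Longrightarrow> f g \<noteq> \<zero> \<Longrightarrow> hahn_val f \<le> g"
  using hahn_val_least[of f] by (auto simp: hahn_zero)

lemma hahn_val_ge_iff:
  assumes "f \<in> carrier hahn"
  shows "f = \<zero>\<^bsub>hahn\<^esub> \<or> g \<le> hahn_val f \<longleftrightarrow> (\<forall>a<g. f a = \<zero>)"
proof (intro iffI allI impI)
  show "f a = \<zero>" if "f = \<zero>\<^bsub>hahn\<^esub> \<or> g \<le> hahn_val f" "a < g" for a
    using that hahn_val_le[OF assms, of a] by (metis hahn_zero leD order.trans)
  show "f = \<zero>\<^bsub>hahn\<^esub> \<or> g \<le> hahn_val f" if "\<forall>a<g. f a = \<zero>"
    using that hahn_val_coeff_nonzero[OF assms] not_le by blast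
qed

lemma hahn_val_monom_series: "c \<noteq> \<zero> \<Longrightarrow> hahn_val (monom_series c g) = g"
  unfolding hahn_val_def by (rule Least_equality) (auto simp: monom_series_def split: if_splits)

lemma monom_series_nonzero: "c \<noteq> \<zero> \<Longrightarrow> monom_series c g \<noteq> \<zero>\<^bsub>hahn\<^esub>"
  by (auto simp: monom_series_def hahn_zero dest: fun_cong[where x = g])

lemma hahn_val_add:
  fixes f h :: "'g::linordered_ab_group_add \<Rightarrow> 'a"
  assumes "f \<in> carrier hahn" "h \<in> carrier hahn" "f \<oplus>\<^bsub>hahn\<^esub> h \<noteq> \<zero>\<^bsub>hahn\<^esub>"
  shows "min (hahn_val f) (hahn_val h) \<le> hahn_val (f \<oplus>\<^bsub>hahn\<^esub> h)"
proof -
  interpret H: cring "hahn :: ('g \<Rightarrow> 'a) ring" by (rule hahn_cring)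
  let ?g = "hahn_val (f \<oplus>\<^bsub>hahn\<^esub> h)"
  have "f ?g \<oplus> h ?g \<noteq> \<zero>"
    using hahn_val_coeff_nonzero[OF H.a_closed[OF assms(1,2)] assms(3)] by (simp add: hahn_add)
  then have "f ?g \<noteq> \<zero> \<or> h ?g \<noteq> \<zero>" by auto
  then show ?thesis
    using hahn_val_le assms(1,2) by (auto simp: min_le_iff_disj)
qed

end

lemma (in "domain") hahn_val_mult:
  assumes f: "f \<in> carrier hahn" "f \<noteq> \<zero>\<^bsub>hahn\<^esub>" and h: "h \<in> carrier hahn" "h \<noteq> \<zero>\<^bsub>hahn\<^esub>"
  shows "hahn_val (f \<otimes>\<^bsub>hahn\<^esub> h) = hahn_val f + hahn_val h"
  unfolding hahn_val_def[of "f \<otimes>\<^bsub>hahn\<^esub> h"]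
proof (rule Least_equality)
  have "(f \<otimes>\<^bsub>hahn\<^esub> h) (hahn_val f + hahn_val h) = f (hahn_val f) \<otimes> h (hahn_val h)"
    using f h by (intro hahn_mult_lowest_coeff hahn_val_le)
  then show "(f \<otimes>\<^bsub>hahn\<^esub> h) (hahn_val f + hahn_val h) \<noteq> \<zero>"
    using hahn_val_coeff_nonzero[OF f] hahn_val_coeff_nonzero[OF h]
      hahn_coeff_closed[OF f(1)] hahn_coeff_closed[OF h(1)] by (simp add: integral_iff)
  show "hahn_val f + hahn_val h \<le> g" if "(f \<otimes>\<^bsub>hahn\<^esub> h) g \<noteq> \<zero>" for g
    using f h by (intro hahn_mult_bounded_below[OF that] hahn_val_le)
qed

subsection \<open>Inverses\<close>

lemma (in cring) exists_recursive_inverse_series: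
  fixes u :: "'g::linordered_ab_group_add \<Rightarrow> 'a"
  assumes S: "\<And>a. a \<in> S \<Longrightarrow> 0 < a" and u: "\<And>a. u a \<in> carrier R"
    and M: "wfp_on M (<)"
  obtains k where "range k \<subseteq> carrier R" "supp k \<subseteq> M"
    and "\<forall>g\<in>M. k g = (if g = 0 then \<one> else \<zero>) \<ominus> (\<Oplus>a\<in>{a \<in> S. g - a \<in> M}. u a \<otimes> k (g - a))"
proof -
  define F :: "('g \<Rightarrow> 'a) \<Rightarrow> 'g \<Rightarrow> 'a" where
    "F k g = (if g \<in> M then (if g = 0 then \<one> else \<zero>)
      \<ominus> (\<Oplus>a\<in>{a \<in> S. g - a \<in> M}. u a \<otimes> k (g - a)) else \<zero>)" for k g
  define less_on_M where "less_on_M = {(a, b). a < b \<and> a \<in> M \<and> b \<in> M}"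
  define k where "k = wfrec less_on_M F"
  have "wf less_on_M"
    using M unfolding less_on_M_def by (subst (asm) wfp_on_iff_wfp) (simp add: wfp_def)
  then have k_unfold: "k g = F (cut k less_on_M g) g" for g
    unfolding k_def by (rule wfrec)
  have cut: "cut k less_on_M g (g - a) = k (g - a)" if "g \<in> M" "a \<in> {a \<in> S. g - a \<in> M}" for g a
    using that S by (intro cut_apply) (simp add: less_on_M_def)
  have supp: "supp k \<subseteq> M" using k_unfold by (auto simp: F_def)
  have closed: "k g \<in> carrier R" for g
  proof (cases "g \<in> M")
    case True
    show ?thesis using M
    proof (induction g rule: wfp_on_induct)
      case (less g)
      then have "u a \<otimes> cut k less_on_M g (g - a) \<in> carrier R" if "a \<in> {a \<in> S. g - a \<in> M}" for a
        using that S u by (simp add: cut)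
      then show ?case unfolding k_unfold[of g] F_def by (auto intro!: minus_closed finsum_closed)
    qed (rule True)
  next
    case False
    then have "k g = \<zero>" using supp by auto
    then show ?thesis by simp
  qed
  have "k g = (if g = 0 then \<one> else \<zero>) \<ominus> (\<Oplus>a\<in>{a \<in> S. g - a \<in> M}. u a \<otimes> k (g - a))" if "g \<in> M" for g
  proof -
    have "(\<Oplus>a\<in>{a \<in> S. g - a \<in> M}. u a \<otimes> cut k less_on_M g (g - a))
      = (\<Oplus>a\<in>{a \<in> S. g - a \<in> M}. u a \<otimes> k (g - a))"
      using cut[OF that] closed u by (intro finsum_cong') auto
    then show ?thesis using that k_unfold[of g] by (simp add: F_def)
  qed
  then show thesis using closed supp by (intro that[of k]) auto
qed

lemma (in cring) hahn_unit_if_wf_submonoid: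
  fixes u :: "'g::linordered_ab_group_add \<Rightarrow> 'a"
  assumes u: "u \<in> carrier hahn" "u 0 = \<one>" "\<And>a. u a \<noteq> \<zero> \<Longrightarrow> 0 \<le> a"
    and M: "wfp_on M (<)" "0 \<in> M" "\<And>a b. u a \<noteq> \<zero> \<Longrightarrow> b \<in> M \<Longrightarrow> a + b \<in> M"
  obtains k where "k \<in> carrier hahn" "u \<otimes>\<^bsub>hahn\<^esub> k = \<one>\<^bsub>hahn\<^esub>"
proof -
  define S where "S = supp u - {0}"
  have pos: "0 < a" if "a \<in> S" for a using that u(3) by (auto simp: S_def less_le)
  have wf: "wfp_on S (<)" using u(1) by (auto simp: S_def hahn_carrier_iff elim: wfp_on_subset)
  obtain k where k: "range k \<subseteq> carrier R" "supp k \<subseteq> M"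
    and rec: "\<forall>g\<in>M. k g = (if g = 0 then \<one> else \<zero>) \<ominus> (\<Oplus>a\<in>{a \<in> S. g - a \<in> M}. u a \<otimes> k (g - a))"
    by (rule exists_recursive_inverse_series[where u = u, OF pos hahn_coeff_closed[OF u(1)] M(1)])
  have k_hahn: "k \<in> carrier hahn"
    using k(1) wfp_on_subset[OF M(1) k(2)] by (simp add: hahn_carrier_iff)
  note [simp] = hahn_coeff_closed[OF k_hahn] hahn_coeff_closed[OF u(1)]
  have "(u \<otimes>\<^bsub>hahn\<^esub> k) g = \<one>\<^bsub>hahn\<^esub> g" for g
  proof (cases "g \<in> M")
    case True
    let ?A = "{a \<in> S. g - a \<in> M}" and ?tail = "\<Oplus>a\<in>{a \<in> S. g - a \<in> M}. u a \<otimes> k (g - a)"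
    have A: "finite ?A" "0 \<notin> ?A" using finite_wfp_on_less_fibre[OF wf M(1)] by (auto simp: S_def)
    have tail: "?tail \<in> carrier R" by (auto intro!: finsum_closed)
    have "(u \<otimes>\<^bsub>hahn\<^esub> k) g = (\<Oplus>a\<in>insert 0 ?A. u a \<otimes> k (g - a))"
      using k(2) A(1) by (intro hahn_mult_eq_finsum u(1) k_hahn) (auto simp: S_def)
    also have "\<dots> = k g \<oplus> ?tail" using A by (subst finsum_insert) (auto simp: u(2))
    also have "k g = \<one>\<^bsub>hahn\<^esub> g \<ominus> ?tail" using rec True unfolding hahn_one by blast
    also have "\<one>\<^bsub>hahn\<^esub> g \<ominus> ?tail \<oplus> ?tail = \<one>\<^bsub>hahn\<^esub> g"
      using tail by (simp add: hahn_one a_minus_def a_assoc l_neg)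
    finally show ?thesis .
  next
    case False
    have "g \<notin> supp u + supp k" using False k(2) M(3) by (auto elim!: set_plus_elim)
    then have "(u \<otimes>\<^bsub>hahn\<^esub> k) g = \<zero>" using supp_hahn_mult_subset[of u k] by blast
    then show ?thesis using False M(2) by (auto simp: hahn_one)
  qed
  then show thesis using that[OF k_hahn] by blast
qed

lemma (in cring) hahn_unit_if_const_coeff_one:
  fixes u :: "'g::linordered_ab_group_add \<Rightarrow> 'a"
  assumes u: "u \<in> carrier hahn" "u 0 = \<one>" "\<And>a. u a \<noteq> \<zero> \<Longrightarrow> 0 \<le> a"
  obtains k where "k \<in> carrier hahn" "u \<otimes>\<^bsub>hahn\<^esub> k = \<one>\<^bsub>hahn\<^esub>"
proof -
  define S where "S = supp u - {0}"
  have wf: "wfp_on (sum_list ` lists S) (<)"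
  proof (rule wfp_on_less_sum_list)
    show "wfp_on S (<)" using u(1) by (auto simp: S_def hahn_carrier_iff elim: wfp_on_subset)
    show "0 < a" if "a \<in> S" for a using that u(3) by (auto simp: S_def less_le)
  qed
  have zero: "0 \<in> sum_list ` lists S" by (rule image_eqI[of _ _ "[]"]) simp_all
  have "a + b \<in> sum_list ` lists S" if "u a \<noteq> \<zero>" and b: "b \<in> sum_list ` lists S" for a b
  proof (cases "a = 0")
    case False
    obtain xs where "xs \<in> lists S" "b = sum_list xs" using b by blast
    then show ?thesis using that(1) False
      by (intro image_eqI[of _ _ "a # xs"]) (simp_all add: S_def)
  qed (simp add: b)
  then show thesis using hahn_unit_if_wf_submonoid[OF u wf zero] that by blast
qed

lemma (in field) hahn_field: "field (hahn :: ('g::linordered_ab_group_add \<Rightarrow> 'a) ring)"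
proof -
  interpret H: cring "hahn :: ('g \<Rightarrow> 'a) ring" by (rule hahn_cring)
  show ?thesis
  proof (rule H.cring_fieldI2)
    show "\<zero>\<^bsub>hahn\<^esub> \<noteq> (\<one>\<^bsub>hahn\<^esub> :: 'g \<Rightarrow> 'a)"
      using monom_series_nonzero[OF one_not_zero] by (metis hahn_one_eq_monom_series)
    fix f :: "'g \<Rightarrow> 'a" assume f: "f \<in> carrier hahn" "f \<noteq> \<zero>\<^bsub>hahn\<^esub>"
    let ?c = "inv (f (hahn_val f))"
    have c: "?c \<in> carrier R" "?c \<otimes> f (hahn_val f) = \<one>"
      using hahn_val_coeff_nonzero[OF f] hahn_coeff_closed[OF f(1)] by (simp_all add: field_Units)
    let ?t = "monom_series ?c (- hahn_val f)"
    have t: "?t \<in> carrier hahn" using c(1) by (rule monom_series_closed)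
    have coeff: "(?t \<otimes>\<^bsub>hahn\<^esub> f) g = ?c \<otimes> f (g + hahn_val f)" for g
      using monom_series_mult_coeff[OF c(1) f(1)] by simp
    have "0 \<le> g" if "(?t \<otimes>\<^bsub>hahn\<^esub> f) g \<noteq> \<zero>" for g
    proof -
      have "f (g + hahn_val f) \<noteq> \<zero>" using that c(1) by (auto simp: coeff)
      then show ?thesis using hahn_val_le[OF f(1)] by fastforce
    qed
    moreover have "(?t \<otimes>\<^bsub>hahn\<^esub> f) 0 = \<one>" using c(2) by (simp add: coeff)
    ultimately obtain k where k: "k \<in> carrier hahn" "(?t \<otimes>\<^bsub>hahn\<^esub> f) \<otimes>\<^bsub>hahn\<^esub> k = \<one>\<^bsub>hahn\<^esub>"
      using hahn_unit_if_const_coeff_one[OF H.m_closed[OF t f(1)]] by blast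
    then show "\<exists>h\<in>carrier hahn. f \<otimes>\<^bsub>hahn\<^esub> h = \<one>\<^bsub>hahn\<^esub>"
      using t f(1) by (intro bexI[of _ "?t \<otimes>\<^bsub>hahn\<^esub> k"]) (simp_all add: H.m_ac)
  qed
qed

section \<open>Valued fields\<close>

locale valued_field = field R for R (structure) +
  fixes v :: "'a \<Rightarrow> 'g::linordered_ab_group_add"
  assumes v_mult: "\<lbrakk>x \<in> carrier R; y \<in> carrier R; x \<noteq> \<zero>; y \<noteq> \<zero>\<rbrakk> \<Longrightarrow> v (x \<otimes> y) = v x + v y"
    and v_add: "\<lbrakk>x \<in> carrier R; y \<in> carrier R; x \<noteq> \<zero>; y \<noteq> \<zero>; x \<oplus> y \<noteq> \<zero>\<rbrakk> \<Longrightarrow>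
      min (v x) (v y) \<le> v (x \<oplus> y)"
    and v_surj: "\<exists>x\<in>carrier R. x \<noteq> \<zero> \<and> v x = g"

lemma (in field) hahn_valued_field:
  "valued_field (hahn :: ('g::linordered_ab_group_add \<Rightarrow> 'a) ring) hahn_val"
proof -
  interpret H: field "hahn :: ('g \<Rightarrow> 'a) ring" by (rule hahn_field)
  show ?thesis
  proof
    show "\<exists>f\<in>carrier hahn. f \<noteq> \<zero>\<^bsub>hahn\<^esub> \<and> hahn_val f = g" for g :: 'g
      by (intro bexI[of _ "monom_series \<one> g"])
        (simp_all add: monom_series_nonzero hahn_val_monom_series monom_series_closed)
  qed (simp_all add: hahn_val_mult hahn_val_add)
qed

lemma (in valued_field) valued_field_comp_ring_hom:
  assumes "field Q" "e \<in> ring_hom Q R" and surj: "\<And>g. \<exists>x\<in>carrier Q. x \<noteq> \<zero>\<^bsub>Q\<^esub> \<and> v (e x) = g"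
  shows "valued_field Q (\<lambda>x. v (e x))"
proof -
  interpret Q: field Q by fact
  interpret e: ring_hom_ring Q R e
    using Q.ring_axioms ring_axioms assms(2) by (rule ring_hom_ringI2)
  have "inj_on e (carrier Q)"
    by (rule non_trivial_field_hom_is_inj[OF assms(2,1) field_axioms])
  then have nonzero: "e x \<noteq> \<zero>" if "x \<in> carrier Q" "x \<noteq> \<zero>\<^bsub>Q\<^esub>" for x
    using that inj_onD[of e "carrier Q" x "\<zero>\<^bsub>Q\<^esub>"] by auto
  show ?thesis
  proof
    fix x y assume xy: "x \<in> carrier Q" "y \<in> carrier Q" "x \<noteq> \<zero>\<^bsub>Q\<^esub>" "y \<noteq> \<zero>\<^bsub>Q\<^esub>"
    show "v (e (x \<otimes>\<^bsub>Q\<^esub> y)) = v (e x) + v (e y)"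
      using xy nonzero by (simp add: v_mult)
    assume "x \<oplus>\<^bsub>Q\<^esub> y \<noteq> \<zero>\<^bsub>Q\<^esub>"
    then have "e x \<oplus> e y \<noteq> \<zero>" using nonzero[of "x \<oplus>\<^bsub>Q\<^esub> y"] xy by simp
    then show "min (v (e x)) (v (e y)) \<le> v (e (x \<oplus>\<^bsub>Q\<^esub> y))"
      using xy nonzero by (simp add: v_add)
  qed (rule surj)
qed

lemma cosets_in_eq_image: "cosets_in Q M N = (\<lambda>a. a <+\<^bsub>Q\<^esub> N) ` M"
  by (auto simp: cosets_in_def a_l_coset_def')

context valued_field
begin

definition value_ideal :: "'g \<Rightarrow> 'a set" where
  "value_ideal g = {x \<in> carrier R. x = \<zero> \<or> g \<le> v x}"

abbreviation valuation_ring :: "'a set" where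
  "valuation_ring \<equiv> value_ideal 0"

lemma value_ideal_carrier: "x \<in> value_ideal g \<Longrightarrow> x \<in> carrier R"
  by (simp add: value_ideal_def)

lemma mem_value_ideal_iff: "x \<in> carrier R \<Longrightarrow> x \<noteq> \<zero> \<Longrightarrow> x \<in> value_ideal g \<longleftrightarrow> g \<le> v x"
  by (simp add: value_ideal_def)

lemma zero_in_value_ideal: "\<zero> \<in> value_ideal g"
  by (simp add: value_ideal_def)

lemma v_one: "v \<one> = 0"
  using v_mult[of \<one> \<one>] by simp

lemma v_a_inv:
  assumes "x \<in> carrier R" "x \<noteq> \<zero>"
  shows "v (\<ominus> x) = v x"
proof -
  have nonzero: "\<ominus> \<one> \<noteq> \<zero>" by (metis add.inv_eq_1_iff one_closed one_not_zero)
  have "v (\<ominus> \<one>) + v (\<ominus> \<one>) = v (\<ominus> \<one> \<otimes> \<ominus> \<one>)" using nonzero by (simp add: v_mult)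
  also have "\<dots> = 0" by (simp add: l_minus v_one)
  finally have "v (\<ominus> \<one>) = 0" by simp
  then have "v (\<ominus> \<one> \<otimes> x) = v x" using v_mult[of "\<ominus> \<one>" x] nonzero assms by simp
  then show ?thesis using assms by (simp add: l_minus)
qed

lemma inv_nonzero: "x \<in> carrier R \<Longrightarrow> x \<noteq> \<zero> \<Longrightarrow> inv x \<in> carrier R \<and> inv x \<noteq> \<zero>"
  using Units_inv_Units field_Units by auto

lemma v_m_inv:
  assumes "x \<in> carrier R" "x \<noteq> \<zero>"
  shows "v (inv x) = - v x"
proof -
  have "v x + v (inv x) = v (x \<otimes> inv x)" using v_mult assms inv_nonzero by simp
  also have "\<dots> = 0" using assms by (simp add: field_Units v_one)
  finally show ?thesis by (simp add: add_eq_0_iff)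
qed

lemma value_ideal_add:
  assumes "x \<in> value_ideal g" "y \<in> value_ideal g"
  shows "x \<oplus> y \<in> value_ideal g"
proof (cases "x = \<zero> \<or> y = \<zero> \<or> x \<oplus> y = \<zero>")
  case False
  then have "g \<le> min (v x) (v y)" using assms by (simp add: value_ideal_def)
  also have "\<dots> \<le> v (x \<oplus> y)" using False assms by (intro v_add) (simp_all add: value_ideal_carrier)
  finally show ?thesis using False assms by (simp add: mem_value_ideal_iff value_ideal_carrier)
qed (use assms in \<open>auto simp: value_ideal_carrier zero_in_value_ideal\<close>)

lemma value_ideal_a_inv: "x \<in> value_ideal g \<Longrightarrow> \<ominus> x \<in> value_ideal g"
  by (cases "x = \<zero>") (auto simp: value_ideal_def v_a_inv)

lemma value_ideal_mult: "x \<in> value_ideal g \<Longrightarrow> y \<in> value_ideal h \<Longrightarrow> x \<otimes> y \<in> value_ideal (g + h)"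
  by (cases "x = \<zero> \<or> y = \<zero>") (auto simp: value_ideal_def v_mult add_mono)

lemma mult_mem_value_ideal_iff:
  assumes "r \<in> carrier R" "r \<noteq> \<zero>" "x \<in> carrier R"
  shows "r \<otimes> x \<in> value_ideal (v r + g) \<longleftrightarrow> x \<in> value_ideal g"
  using assms by (cases "x = \<zero>") (simp_all add: value_ideal_def v_mult integral_iff)

lemma abelian_subgroup_value_ideal: "abelian_subgroup (value_ideal g) R"
proof (rule abelian_subgroupI3[OF additive_subgroup.intro])
  show "subgroup (value_ideal g) (add_monoid R)"
    using zero_in_value_ideal[of g]
    by (intro add.subgroupI)
      (auto simp: value_ideal_add value_ideal_a_inv a_inv_def[symmetric] dest: value_ideal_carrier)
qed (rule abelian_group_axioms)

lemma l_coset_value_ideal_eq_iff: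
  assumes "a \<in> carrier R" "b \<in> carrier R"
  shows "a <+ value_ideal g = b <+ value_ideal g \<longleftrightarrow> a \<ominus> b \<in> value_ideal g"
proof -
  interpret I: abelian_subgroup "value_ideal g" R by (rule abelian_subgroup_value_ideal)
  have "a <+ value_ideal g = b <+ value_ideal g \<longleftrightarrow> value_ideal g +> a = value_ideal g +> b"
    using assms I.a_coset_eq by simp
  also have "\<dots> \<longleftrightarrow> a \<in> value_ideal g +> b"
    using assms I.a_repr_independence' I.a_rcos_self by metis
  finally show ?thesis using assms by (simp add: I.a_rcos_module_minus[OF ring_axioms])
qed

lemma principal_valuation_ring:
  assumes "r \<in> carrier R" "r \<noteq> \<zero>"
  shows "principal R valuation_ring r = value_ideal (v r)"
proof (intro equalityI subsetI)
  fix y assume "y \<in> principal R valuation_ring r"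
  then show "y \<in> value_ideal (v r)"
    using mult_mem_value_ideal_iff[OF assms, of _ 0]
    by (auto simp: principal_def dest: value_ideal_carrier)
next
  fix y assume y: "y \<in> value_ideal (v r)"
  have "r \<otimes> (inv r \<otimes> y) = y"
    using assms inv_nonzero[OF assms] value_ideal_carrier[OF y]
    by (simp add: m_assoc[symmetric] field_Units)
  moreover from this have "inv r \<otimes> y \<in> valuation_ring"
    using mult_mem_value_ideal_iff[OF assms, of "inv r \<otimes> y" 0] inv_nonzero[OF assms]
      y value_ideal_carrier[OF y] by simp
  ultimately show "y \<in> principal R valuation_ring r" unfolding principal_def by force
qed

lemma rdvd_valuation_ring_iff:
  assumes "a \<in> carrier R" "a \<noteq> \<zero>" "b \<in> carrier R" "b \<noteq> \<zero>"
  shows "rdvd R valuation_ring a b \<longleftrightarrow> v a \<le> v b"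
proof -
  have "rdvd R valuation_ring a b \<longleftrightarrow> b \<in> principal R valuation_ring a"
    by (auto simp: rdvd_def principal_def)
  then show ?thesis using assms by (simp add: principal_valuation_ring mem_value_ideal_iff)
qed

lemma subring_valuation_ring: "subring valuation_ring R"
  by (rule subringI)
    (use value_ideal_mult[of _ 0 _ 0] in \<open>auto simp: value_ideal_add value_ideal_a_inv
      dest: value_ideal_carrier\<close>,
      simp add: value_ideal_def v_one)

lemma Units_valuation_ring: "Units (R\<lparr>carrier := valuation_ring\<rparr>) = {x \<in> carrier R. x \<noteq> \<zero> \<and> v x = 0}"
proof (intro equalityI subsetI)
  fix x assume "x \<in> Units (R\<lparr>carrier := valuation_ring\<rparr>)"
  then obtain y where xy: "x \<in> valuation_ring" "y \<in> valuation_ring" "x \<otimes> y = \<one>"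
    by (auto simp: Units_def)
  then have "x \<noteq> \<zero>" "y \<noteq> \<zero>" by (auto simp: value_ideal_def)
  moreover from this have "v x + v y = 0"
    using v_mult[of x y] xy by (simp add: v_one value_ideal_carrier)
  ultimately show "x \<in> {x \<in> carrier R. x \<noteq> \<zero> \<and> v x = 0}"
    using xy by (simp add: value_ideal_def add_nonneg_eq_0_iff)
next
  fix x assume "x \<in> {x \<in> carrier R. x \<noteq> \<zero> \<and> v x = 0}"
  then have x: "x \<in> carrier R" "x \<noteq> \<zero>" "v x = 0" by auto
  then have "inv x \<in> valuation_ring" "inv x \<otimes> x = \<one>" "x \<otimes> inv x = \<one>" "x \<in> valuation_ring"
    using v_m_inv[of x] inv_nonzero[of x] by (auto simp: value_ideal_def field_Units)
  then show "x \<in> Units (R\<lparr>carrier := valuation_ring\<rparr>)" by (auto simp: Units_def)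
qed

lemma ideals_of_valuation_ring_linear:
  assumes I: "ideal I (R\<lparr>carrier := valuation_ring\<rparr>)"
    and J: "ideal J (R\<lparr>carrier := valuation_ring\<rparr>)"
  shows "I \<subseteq> J \<or> J \<subseteq> I"
proof (rule ccontr)
  have absorb: "y \<in> I" if I: "ideal I (R\<lparr>carrier := valuation_ring\<rparr>)" and x: "x \<in> I" "x \<noteq> \<zero>"
    and y: "y \<in> carrier R" "y \<noteq> \<zero>" "v x \<le> v y" for I x y
  proof -
    have "x \<in> carrier R" using ideal.Icarr[OF I x(1)] by (simp add: value_ideal_carrier)
    then have "y \<in> principal R valuation_ring x" using x y
      by (simp add: principal_valuation_ring mem_value_ideal_iff)
    then show "y \<in> I" using ideal.I_r_closed[OF I x(1)] by (auto simp: principal_def)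
  qed
  assume "\<not> (I \<subseteq> J \<or> J \<subseteq> I)"
  then obtain x y where xy: "x \<in> I" "x \<notin> J" "y \<in> J" "y \<notin> I" by blast
  have "\<zero> \<in> I" "\<zero> \<in> J"
    using additive_subgroup.zero_closed[OF ideal.axioms(1)] I J by fastforce+
  then have "x \<noteq> \<zero>" "y \<noteq> \<zero>" using xy by auto
  moreover have "x \<in> carrier R" "y \<in> carrier R"
    using ideal.Icarr[OF I xy(1)] ideal.Icarr[OF J xy(3)] by (simp_all add: value_ideal_carrier)
  ultimately show False using absorb[OF I xy(1)] absorb[OF J xy(3)] xy linear[of "v x" "v y"]
    by blast
qed

lemma valuation_domain_valuation_ring: "valuation_domain (R\<lparr>carrier := valuation_ring\<rparr>)"
proof -
  have "subdomain valuation_ring R"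
    using subcringI'[OF subring_valuation_ring] integral value_ideal_carrier
    by (intro subdomain.intro subdomain_axioms.intro) auto
  then have "domain (R\<lparr>carrier := valuation_ring\<rparr>)"
    using subdomain_iff[OF subringE(1)[OF subring_valuation_ring]] by simp
  then show ?thesis unfolding valuation_domain_def using ideals_of_valuation_ring_linear by blast
qed

lemma quotient_field_of_valuation_ring: "quotient_field_of R valuation_ring"
  unfolding quotient_field_of_def
proof (intro conjI ballI field_axioms subring_valuation_ring)
  fix y assume y: "y \<in> carrier R"
  have one: "\<one> \<in> valuation_ring" by (rule subringE(3)[OF subring_valuation_ring])
  show "\<exists>a\<in>valuation_ring. \<exists>b\<in>valuation_ring. b \<noteq> \<zero> \<and> y = a \<otimes> inv b"
  proof (cases "y \<in> valuation_ring")
    case True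
    then show ?thesis using y one by (intro bexI[of _ y] bexI[of _ \<one>]) auto
  next
    case False
    then have neg: "y \<noteq> \<zero>" "v y < 0" using y by (auto simp: value_ideal_def)
    then have "inv y \<in> valuation_ring" using v_m_inv[of y] inv_nonzero[of y] y
      by (simp add: value_ideal_def)
    moreover have "inv (inv y) = y" using y neg by (simp add: field_Units)
    ultimately show ?thesis
      using y one inv_nonzero[OF y neg(1)] by (intro bexI[of _ \<one>] bexI[of _ "inv y"]) simp_all
  qed
qed

lemma valuation_domain_in_if_nontrivial:
  assumes "g < (0 :: 'g)"
  shows "valuation_domain_in R valuation_ring"
proof -
  obtain x where "x \<in> carrier R" "x \<noteq> \<zero>" "v x = g" using v_surj by blast
  then have "valuation_ring \<noteq> carrier R" using assms by (auto simp: value_ideal_def)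
  then show ?thesis
    unfolding valuation_domain_in_def
    using quotient_field_of_valuation_ring valuation_domain_valuation_ring by blast
qed

lemma rspan_subset_value_ideal:
  assumes "S \<subseteq> value_ideal g"
  shows "rspan R valuation_ring S \<subseteq> value_ideal g"
proof
  fix x assume "x \<in> rspan R valuation_ring S"
  then obtain F c where x: "x = (\<Oplus>s\<in>F. c s \<otimes> s)" and F: "finite F" "F \<subseteq> S" "c \<in> F \<rightarrow> valuation_ring"
    unfolding rspan_def by blast
  have "(\<Oplus>s\<in>F. c s \<otimes> s) \<in> value_ideal g"
    using F
  proof (induction F rule: finite_induct)
    case (insert s F)
    have mem: "c t \<otimes> t \<in> value_ideal g" if "t \<in> insert s F" for t
      using value_ideal_mult[of "c t" 0 t g] insert.prems assms that by auto
    then have "(\<Oplus>t\<in>insert s F. c t \<otimes> t) = c s \<otimes> s \<oplus> (\<Oplus>t\<in>F. c t \<otimes> t)"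
      using insert.hyps by (intro finsum_insert) (auto dest: value_ideal_carrier)
    then show ?case using insert mem by (simp add: value_ideal_add)
  qed (simp add: zero_in_value_ideal)
  then show "x \<in> value_ideal g" by (simp add: x)
qed

lemma rspan_carrier: "rspan R valuation_ring (carrier R) = carrier R"
proof (intro equalityI subsetI)
  fix x assume "x \<in> rspan R valuation_ring (carrier R)"
  then show "x \<in> carrier R"
    by (auto simp: rspan_def Pi_iff subset_iff value_ideal_carrier intro!: finsum_closed)
next
  fix x assume "x \<in> carrier R"
  then show "x \<in> rspan R valuation_ring (carrier R)"
    unfolding rspan_def mem_Collect_eq using subringE(3)[OF subring_valuation_ring]
    by (intro exI[of _ "{x}"] exI[of _ "\<lambda>_. \<one>"]) auto
qed

end

subsection \<open>Value groups\<close>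

definition additive_group :: "'g::ab_group_add monoid" where
  "additive_group = \<lparr>carrier = UNIV, monoid.mult = (+), one = 0\<rparr>"

lemma group_additive_group: "group additive_group"
  by (rule groupI) (auto simp: additive_group_def add.assoc intro: exI[of _ "- _"])

context valued_field
begin

definition coset_value :: "'a set \<Rightarrow> 'g" where
  "coset_value A = the_elem (v ` A)"

lemma group_value_group: "group (value_group R valuation_ring)"
  and coset_value_iso: "coset_value \<in> iso (value_group R valuation_ring) additive_group"
proof -
  \<comment> \<open>HOL-Algebra has two constants \<open>mult_of\<close>, with the same definition.\<close>
  have "group (mult_of R)"
    using field_mult_group by (simp add: Multiplicative_Group.mult_of_def mult_of_def)
  then interpret group_hom "mult_of R" "additive_group :: 'g monoid" v
    by (intro group_hom.intro group_hom_axioms.intro group_additive_group)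
      (auto simp: hom_def additive_group_def v_mult)
  have kernel: "kernel (mult_of R) additive_group v = Units (R\<lparr>carrier := valuation_ring\<rparr>)"
    by (auto simp: kernel_def Units_valuation_ring additive_group_def)
  then show "group (value_group R valuation_ring)"
    unfolding value_group_def using normal.factorgroup_is_group[OF normal_kernel] by simp
  have "g \<in> v ` carrier (mult_of R)" for g using v_surj[of g] by auto
  then have "v ` carrier (mult_of R) = carrier additive_group" by (auto simp: additive_group_def)
  then show "coset_value \<in> iso (value_group R valuation_ring) additive_group"
    using FactGroup_iso_set unfolding value_group_def coset_value_def[abs_def] kernel by simp
qed

lemma value_coset:
  assumes "A \<in> carrier (value_group R valuation_ring)"
  shows "A \<noteq> {}" "a \<in> A \<Longrightarrow> a \<in> carrier R \<and> a \<noteq> \<zero> \<and> v a = coset_value A"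
proof -
  obtain x where x: "x \<in> carrier R" "x \<noteq> \<zero>" "A = (\<Union>u\<in>{u \<in> carrier R. u \<noteq> \<zero> \<and> v u = 0}. {u \<otimes> x})"
    using assms by (auto simp: value_group_def FactGroup_def RCOSETS_def
      r_coset_def Units_valuation_ring)
  have mem: "a \<in> carrier R \<and> a \<noteq> \<zero> \<and> v a = v x" if a: "a \<in> A" for a
  proof -
    obtain u where "u \<in> carrier R" "u \<noteq> \<zero>" "v u = 0" "a = u \<otimes> x"
      using a unfolding x(3) by blast
    then show ?thesis using x(1,2) by (simp add: v_mult integral_iff)
  qed
  have "\<one> \<otimes> x \<in> A" unfolding x(3) by (rule UN_I[of \<one>]) (simp_all add: v_one)
  then show "A \<noteq> {}" by blast
  then have "v ` A = {v x}" using mem by auto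
  then show "a \<in> A \<Longrightarrow> a \<in> carrier R \<and> a \<noteq> \<zero> \<and> v a = coset_value A"
    using mem by (simp add: coset_value_def)
qed

lemma value_le_iff:
  assumes A: "A \<in> carrier (value_group R valuation_ring)"
    and B: "B \<in> carrier (value_group R valuation_ring)"
  shows "value_le R valuation_ring A B \<longleftrightarrow> coset_value A \<le> coset_value B"
proof -
  have "b \<otimes> inv a \<in> valuation_ring \<longleftrightarrow> coset_value A \<le> coset_value B" if "a \<in> A" "b \<in> B" for a b
    using value_coset(2)[OF A that(1)] value_coset(2)[OF B that(2)] inv_nonzero[of a]
    by (simp add: mem_value_ideal_iff integral_iff v_mult v_m_inv)
  then show ?thesis
    unfolding value_le_def using value_coset(1)[OF A] value_coset(1)[OF B] by blast
qed

end

lemma same_value_group_valuation_ring: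
  fixes v :: "'a \<Rightarrow> 'g::linordered_ab_group_add" and w :: "'b \<Rightarrow> 'g"
  assumes "valued_field Q v" "valued_field Q' w"
  shows "same_value_group Q (valued_field.valuation_ring Q v) Q' (valued_field.valuation_ring Q' w)"
proof -
  interpret V: valued_field Q v by fact
  interpret W: valued_field Q' w by fact
  let ?V = "value_group Q V.valuation_ring" and ?W = "value_group Q' W.valuation_ring"
  have W_surj: "W.coset_value ` carrier ?W = UNIV"
    using W.coset_value_iso by (simp add: iso_def bij_betw_def additive_group_def)
  define \<phi> where "\<phi> = inv_into (carrier ?W) W.coset_value \<circ> V.coset_value"
  have iso: "\<phi> \<in> iso ?V ?W"
    unfolding \<phi>_def
    by (intro iso_set_trans[OF V.coset_value_iso] group.iso_set_sym
      W.group_value_group W.coset_value_iso)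
  have coset_value_\<phi>: "W.coset_value (\<phi> A) = V.coset_value A" for A
    unfolding \<phi>_def comp_def by (rule f_inv_into_f) (simp add: W_surj)
  have "\<phi> A \<in> carrier ?W" if "A \<in> carrier ?V" for A
    using iso that by (auto simp: iso_def hom_def)
  then have "value_le Q V.valuation_ring A B \<longleftrightarrow> value_le Q' W.valuation_ring (\<phi> A) (\<phi> B)"
    if "A \<in> carrier ?V" "B \<in> carrier ?V" for A B
    using that by (simp add: V.value_le_iff W.value_le_iff coset_value_\<phi>)
  then show ?thesis unfolding same_value_group_def using iso by blast
qed

subsection \<open>Quotients of a valuation ring with value group of cofinality \<open>\<omega>\<^sub>1\<close>\<close>

locale omega1_valued_field = valued_field R v
  for R (structure) and v :: "'a \<Rightarrow> 'g::linordered_ab_group_add" +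
  fixes u :: "omega1 \<Rightarrow> 'g"
  assumes u_less: "i < j \<Longrightarrow> u j < u i" and u_pos: "0 < u i" and u_cofinal: "\<exists>i. g < u i"
    and carrier_ordLeq_aleph1: "|carrier R| \<le>o aleph1"
begin

definition element_of_value :: "'g \<Rightarrow> 'a" where
  "element_of_value g = (SOME x. x \<in> carrier R \<and> x \<noteq> \<zero> \<and> v x = g)"

lemma element_of_value:
  shows "element_of_value g \<in> carrier R" "element_of_value g \<noteq> \<zero>" "v (element_of_value g) = g"
proof -
  have "\<exists>x. x \<in> carrier R \<and> x \<noteq> \<zero> \<and> v x = g" using v_surj by blast
  then have "element_of_value g \<in> carrier R \<and> element_of_value g \<noteq> \<zero> \<and> v (element_of_value g) = g"
    unfolding element_of_value_def by (rule someI_ex)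
  then show "element_of_value g \<in> carrier R" "element_of_value g \<noteq> \<zero>" "v (element_of_value g) = g"
    by auto
qed

lemma countable_strict_upper_bound:
  assumes "countable (S :: 'g set)"
  obtains g where "0 < g" "\<And>s. s \<in> S \<Longrightarrow> s < g"
proof -
  obtain index where index: "\<And>s. s < u (index s)" using u_cofinal by metis
  obtain i where "\<And>j. j \<in> index ` S \<Longrightarrow> i < j"
    using countable_omega1_strict_lower_bound[OF countable_image[OF assms]] by metis
  then have "s < u i" if "s \<in> S" for s using index[of s] u_less that by (meson imageI less_trans)
  then show thesis using that u_pos by blast
qed

lemma valuation_domain_in_valuation_ring: "valuation_domain_in R valuation_ring"
  using valuation_domain_in_if_nontrivial[of "- u i" for i] u_pos by simp

lemma card_eq_aleph1_valuation_ring: "card_eq_aleph1 valuation_ring"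
proof -
  have "|valuation_ring| \<le>o |carrier R|" by (intro card_of_mono1 subsetI) (rule value_ideal_carrier)
  then have "|valuation_ring| \<le>o aleph1" using carrier_ordLeq_aleph1 by (rule ordLeq_transitive)
  moreover have "|UNIV :: omega1 set| \<le>o |valuation_ring|"
  proof (rule card_of_ordLeqI)
    have "inj u" by (rule linorder_injI) (auto dest: u_less)
    moreover have "inj element_of_value" by (rule inj_on_inverseI[of _ v]) (rule element_of_value)
    ultimately show "inj (element_of_value \<circ> u)" by (rule inj_compose[rotated])
    show "(element_of_value \<circ> u) i \<in> valuation_ring" for i
      using element_of_value u_pos by (simp add: mem_value_ideal_iff less_imp_le)
  qed
  then have "aleph1 \<le>o |valuation_ring|"
    by (rule ordIso_ordLeq_trans[OF ordIso_symmetric[OF card_of_omega1]])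
  ultimately show ?thesis unfolding card_eq_aleph1_def by (simp add: ordIso_iff_ordLeq)
qed

lemma aleph1_generated: "\<exists>S\<subseteq>carrier R. card_le_aleph1 S \<and> rspan R valuation_ring S = carrier R"
  using carrier_ordLeq_aleph1 rspan_carrier by (auto simp: card_le_aleph1_def)

lemma not_countably_generated:
  assumes "S \<subseteq> carrier R" "countable S"
  shows "rspan R valuation_ring S \<noteq> carrier R"
proof
  assume eq: "rspan R valuation_ring S = carrier R"
  obtain g where g: "\<And>h. h \<in> (\<lambda>s. - v s) ` S \<Longrightarrow> h < g"
    using countable_strict_upper_bound[OF countable_image[OF assms(2)]] by metis
  have "- g \<le> v s" if "s \<in> S" for s
    using g[of "- v s"] that by (simp add: less_imp_le minus_le_iff[of g])
  then have "S \<subseteq> value_ideal (- g)" using assms(1) by (auto simp: value_ideal_def)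
  then have "element_of_value h \<in> value_ideal (- g)" for h
    using rspan_subset_value_ideal eq element_of_value(1) by blast
  then have "- g \<le> h" for h using element_of_value by (metis mem_value_ideal_iff)
  moreover obtain i where "g < u i" using u_cofinal by blast
  ultimately show False by (meson leD neg_less_iff_less)
qed

lemma omega1_rep_exists: "\<exists>r. omega1_rep R valuation_ring (carrier R) r"
proof
  let ?r = "\<lambda>i. element_of_value (u (Abs_omega1 i))"
  have cover: "x \<in> (\<Union>i\<in>omega1_idx. principal R valuation_ring (inv (?r i)))"
    if x: "x \<in> carrier R" for x
  proof -
    obtain i where "- v x < u i" using u_cofinal by blast
    then have "- u i \<le> v x" by (simp add: less_imp_le minus_le_iff[of "u i"])
    then have "x \<in> principal R valuation_ring (inv (?r (Rep_omega1 i)))"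
      using x element_of_value inv_nonzero[OF element_of_value(1,2)]
      by (cases "x = \<zero>")
        (simp_all add: principal_valuation_ring v_m_inv mem_value_ideal_iff
          zero_in_value_ideal Rep_omega1_inverse)
    then show ?thesis using Rep_omega1 by blast
  qed
  show "omega1_rep R valuation_ring (carrier R) ?r"
    unfolding omega1_rep_def
  proof (intro conjI ballI impI)
    show "?r i \<in> valuation_ring" for i
      using element_of_value u_pos by (simp add: mem_value_ideal_iff less_imp_le)
    show "?r i \<noteq> \<zero>" for i by (rule element_of_value)
    fix j i assume "j \<in> omega1_idx" "i \<in> omega1_idx" "(j, i) \<in> aleph1 \<and> j \<noteq> i"
    then have "u (Abs_omega1 j) < u (Abs_omega1 i)" using omega1_less_iff_aleph1 u_less by blast
    then show "rdvd R valuation_ring (?r j) (?r i)" "\<not> rdvd R valuation_ring (?r i) (?r j)"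
      using element_of_value by (simp_all add: rdvd_valuation_ring_iff less_imp_le not_le)
  next
    show "carrier R = (\<Union>i\<in>omega1_idx. principal R valuation_ring (inv (?r i)))"
      using cover inv_nonzero[OF element_of_value(1,2)]
      by (auto simp: principal_valuation_ring dest: value_ideal_carrier)
  qed
qed

lemma omega1_repD:
  assumes "omega1_rep R valuation_ring (carrier R) r" "i \<in> omega1_idx"
  shows "r i \<in> carrier R" "r i \<noteq> \<zero>"
  using assms value_ideal_carrier unfolding omega1_rep_def by blast+

lemma omega1_rep_cofinal:
  assumes r: "omega1_rep R valuation_ring (carrier R) r"
  obtains i where "i \<in> omega1_idx" "g \<le> v (r i)"
proof -
  have "carrier R = (\<Union>i\<in>omega1_idx. principal R valuation_ring (inv (r i)))"
    using r by (simp add: omega1_rep_def)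
  then obtain i where i: "i \<in> omega1_idx"
      "element_of_value (- g) \<in> principal R valuation_ring (inv (r i))"
    using element_of_value(1) by blast
  note ri = omega1_repD[OF r i(1)]
  have "- v (r i) \<le> - g"
    using i(2) inv_nonzero[OF ri] element_of_value
    by (simp add: principal_valuation_ring v_m_inv[OF ri] mem_value_ideal_iff)
  then show thesis using i(1) that by simp
qed

lemma omega1_rep_less:
  assumes r: "omega1_rep R valuation_ring (carrier R) r"
    and "i \<in> omega1_idx" "j \<in> omega1_idx" "v (r i) < v (r j)"
  shows "(i, j) \<in> aleph1 \<and> i \<noteq> j"
proof -
  have "\<not> rdvd R valuation_ring (r j) (r i)" using assms omega1_repD
    by (simp add: rdvd_valuation_ring_iff)
  then have "\<not> ((j, i) \<in> aleph1 \<and> j \<noteq> i)" using assms unfolding omega1_rep_def by blast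
  moreover have "i \<noteq> j" using assms(4) by auto
  ultimately show ?thesis
    using omega1_less_iff_aleph1 assms(2,3) by (metis Abs_omega1_inject linorder_neqE)
qed

lemma countable_cosets_valuation_ring_if_principal:
  assumes r: "r \<in> carrier R" "r \<noteq> \<zero>" and s: "s \<in> carrier R" "s \<noteq> \<zero>" and le: "v r + g \<le> v s"
    and cnt: "countable (cosets_in R (principal R valuation_ring r) (principal R valuation_ring s))"
  shows "countable (cosets_in R valuation_ring (value_ideal g))"
proof -
  have "(\<lambda>a. r \<otimes> a <+ value_ideal (v s)) ` valuation_ring
      \<subseteq> cosets_in R (principal R valuation_ring r) (principal R valuation_ring s)"
    unfolding cosets_in_eq_image principal_valuation_ring[OF s] by (auto simp: principal_def)
  then have "countable ((\<lambda>a. r \<otimes> a <+ value_ideal (v s)) ` valuation_ring)"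
    using cnt by (rule countable_subset)
  then have "countable ((\<lambda>a. a <+ value_ideal g) ` valuation_ring)"
  proof (rule countable_image_factor)
    fix a b assume ab: "a \<in> valuation_ring" "b \<in> valuation_ring"
      and eq: "r \<otimes> a <+ value_ideal (v s) = r \<otimes> b <+ value_ideal (v s)"
    note [simp] = r ab[THEN value_ideal_carrier]
    have "r \<otimes> (a \<ominus> b) = r \<otimes> a \<ominus> r \<otimes> b" by (simp add: r_distr r_minus a_minus_def)
    also have "\<dots> \<in> value_ideal (v s)" using eq by (simp add: l_coset_value_ideal_eq_iff)
    also have "\<dots> \<subseteq> value_ideal (v r + g)" using le by (auto simp: value_ideal_def)
    finally have "a \<ominus> b \<in> value_ideal g" by (simp add: mult_mem_value_ideal_iff)
    then show "a <+ value_ideal g = b <+ value_ideal g" by (simp add: l_coset_value_ideal_eq_iff)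
  qed
  then show ?thesis by (simp add: cosets_in_eq_image)
qed

lemma essentially_uncountable_type_valuation_ring:
  assumes unc: "uncountable (cosets_in R valuation_ring (value_ideal g))"
  shows "essentially_uncountable_type R valuation_ring (carrier R)"
  unfolding essentially_uncountable_type_def
proof (intro conjI allI impI ballI omega1_rep_exists)
  fix r i assume r: "omega1_rep R valuation_ring (carrier R) r" and i: "i \<in> omega1_idx"
  obtain h where h: "0 < h" "g < h" using countable_strict_upper_bound[of "{g}"] by auto
  obtain j where j: "j \<in> omega1_idx" "v (r i) + h \<le> v (r j)" using omega1_rep_cofinal[OF r] by blast
  have "v (r i) < v (r j)" using h(1) j(2) by (meson less_add_same_cancel1 less_le_trans)
  then have "(i, j) \<in> aleph1 \<and> i \<noteq> j" by (rule omega1_rep_less[OF r i j(1)])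
  moreover have "v (r i) + g \<le> v (r j)" using h(2) j(2)
    by (meson add_left_mono less_imp_le order_trans)
  then have "uncountable
      (cosets_in R (principal R valuation_ring (r i)) (principal R valuation_ring (r j)))"
    using unc countable_cosets_valuation_ring_if_principal omega1_repD[OF r] i j(1) by blast
  ultimately show "\<exists>j\<in>omega1_idx. (i, j) \<in> aleph1 \<and> i \<noteq> j \<and>
      uncountable (cosets_in R (principal R valuation_ring (r i)) (principal R valuation_ring (r j)))"
    using j(1) by blast
qed

lemma strongly_countable_type_valuation_ring:
  assumes "\<And>g. countable (cosets_in R valuation_ring (value_ideal g))"
  shows "strongly_countable_type R valuation_ring (carrier R)"
  unfolding strongly_countable_type_def
  using assms omega1_rep_exists omega1_repD principal_valuation_ring by simp

end

section \<open>Subfields of the field of Hahn series\<close>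

definition field_step :: "('a, 'b) ring_scheme \<Rightarrow> 'a set \<Rightarrow> 'a set" where
  "field_step R Y = Y \<union> a_inv R ` Y \<union> m_inv R ` Y \<union>
    (\<lambda>(x, y). x \<oplus>\<^bsub>R\<^esub> y) ` (Y \<times> Y) \<union> (\<lambda>(x, y). x \<otimes>\<^bsub>R\<^esub> y) ` (Y \<times> Y)"

lemma generate_field_subset_UN_field_step:
  "generate_field R S \<subseteq> (\<Union>n. (field_step R ^^ n) (insert \<one>\<^bsub>R\<^esub> S))" (is "_ \<subseteq> (\<Union>n. ?C n)")
proof
  have mono: "mono ?C" unfolding mono_iff_le_Suc by (auto simp: field_step_def)
  have common_stage: "\<exists>n. x \<in> ?C n \<and> y \<in> ?C n" if xy: "x \<in> (\<Union>n. ?C n)" "y \<in> (\<Union>n. ?C n)" for x y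
  proof -
    obtain m n where "x \<in> ?C m" "y \<in> ?C n" using xy by blast
    then have "x \<in> ?C (max m n)" "y \<in> ?C (max m n)"
      using monoD[OF mono, of m "max m n"] monoD[OF mono, of n "max m n"] by auto
    then show ?thesis by blast
  qed
  have next_stage: "y \<in> (\<Union>n. ?C n)" if "y \<in> field_step R (?C n)" for y n
    using that by (intro UN_I[of "Suc n"]) simp_all
  fix x assume "x \<in> generate_field R S"
  then show "x \<in> (\<Union>n. ?C n)"
  proof (induction rule: generate_field.induct)
    case (eng_add x y)
    then obtain n where "x \<in> ?C n" "y \<in> ?C n" using common_stage by blast
    then show ?case by (intro next_stage[of _ n]) (force simp: field_step_def)
  next
    case (eng_mult x y)
    then obtain n where "x \<in> ?C n" "y \<in> ?C n" using common_stage by blast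
    then show ?case by (intro next_stage[of _ n]) (force simp: field_step_def)
  next
    case (a_inv x)
    then obtain n where "x \<in> ?C n" by blast
    then show ?case by (intro next_stage[of _ n]) (simp add: field_step_def)
  next
    case (m_inv x)
    then obtain n where "x \<in> ?C n" by blast
    then show ?case by (intro next_stage[of _ n]) (simp add: field_step_def)
  qed (rule UN_I[of 0], simp, simp)+
qed

lemma generate_field_Cinfinite_bound:
  assumes "|S| \<le>o r" "Cinfinite r"
  shows "|generate_field R S| \<le>o r"
proof -
  have "|(field_step R ^^ n) (insert \<one>\<^bsub>R\<^esub> S)| \<le>o r" for n
  proof (induction n)
    case 0
    have "|{\<one>\<^bsub>R\<^esub>} \<union> S| \<le>o r"
      using assms by (intro Un_Cinfinite_bound) (simp_all add: countable_Cinfinite_bound)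
    then show ?case by simp
  next
    case (Suc n)
    then show ?case
      using assms(2) by (auto simp: field_step_def intro!: Un_Cinfinite_bound
        ordLeq_image Times_Cinfinite_bound)
  qed
  then have "|\<Union>n. (field_step R ^^ n) (insert \<one>\<^bsub>R\<^esub> S)| \<le>o r"
    using assms(2) by (intro UNION_Cinfinite_bound countable_Cinfinite_bound) simp_all
  then show ?thesis
    by (rule ordLeq_transitive[OF card_of_mono1[OF generate_field_subset_UN_field_step]])
qed

lemma (in field) generate_field_subring_fraction:
  assumes S: "subring S R" and x: "x \<in> generate_field R S"
  shows "\<exists>a\<in>S. \<exists>b\<in>S. b \<noteq> \<zero> \<and> x \<otimes> b = a"
proof -
  note sub = subringE[OF S]
  note closed = subsetD[OF sub(1)] generate_field_in_carrier[OF sub(1)]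
  have nonzero: "b \<otimes> d \<noteq> \<zero>" if "b \<in> S" "d \<in> S" "b \<noteq> \<zero>" "d \<noteq> \<zero>" for b d
    using that closed(1) integral by blast
  show ?thesis
    using x
  proof (induction rule: generate_field.induct)
    case one
    show ?case using sub(3) one_not_zero by (intro bexI[of _ \<one>]) auto
  next
    case (incl x)
    then show ?case using sub(3) one_not_zero closed(1) by (intro bexI[of _ x] bexI[of _ \<one>]) auto
  next
    case (a_inv x)
    then obtain a b where "a \<in> S" "b \<in> S" "b \<noteq> \<zero>" "x \<otimes> b = a" by blast
    then show ?case using a_inv.hyps closed sub(5)
      by (intro bexI[of _ "\<ominus> a"] bexI[of _ b]) (auto simp: l_minus)
  next
    case (m_inv x)
    then obtain a b where ab: "a \<in> S" "b \<in> S" "b \<noteq> \<zero>" "x \<otimes> b = a" by blast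
    have x: "x \<in> carrier R" "x \<in> Units R" using m_inv.hyps closed(2) by (auto simp: field_Units)
    have "inv x \<otimes> a = b" using x closed(1) ab by (auto simp: m_assoc[symmetric])
    moreover have "a \<noteq> \<zero>" using ab x(1) m_inv.hyps(2) closed(1) integral by blast
    ultimately show ?case using ab by blast
  next
    case (eng_add x y)
    then obtain a b c d where ab: "a \<in> S" "b \<in> S" "b \<noteq> \<zero>" "x \<otimes> b = a"
      and cd: "c \<in> S" "d \<in> S" "d \<noteq> \<zero>" "y \<otimes> d = c" by metis
    have "(x \<oplus> y) \<otimes> (b \<otimes> d) = (x \<otimes> b) \<otimes> d \<oplus> (y \<otimes> d) \<otimes> b"
      using closed(1)[OF ab(2)] closed(1)[OF cd(2)] eng_add.hyps[THEN closed(2)] by algebra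
    then show ?case using ab cd sub(6,7) nonzero by metis
  next
    case (eng_mult x y)
    then obtain a b c d where ab: "a \<in> S" "b \<in> S" "b \<noteq> \<zero>" "x \<otimes> b = a"
      and cd: "c \<in> S" "d \<in> S" "d \<noteq> \<zero>" "y \<otimes> d = c" by metis
    have "(x \<otimes> y) \<otimes> (b \<otimes> d) = (x \<otimes> b) \<otimes> (y \<otimes> d)"
      using closed(1)[OF ab(2)] closed(1)[OF cd(2)] eng_mult.hyps[THEN closed(2)] by algebra
    then show ?case using ab cd sub(6) nonzero by metis
  qed
qed

context cring
begin

definition monomials :: "('g::linordered_ab_group_add \<Rightarrow> 'a) set" where
  "monomials = (\<lambda>(c, g). monom_series c g) ` (carrier R \<times> UNIV)"

lemma monom_series_in_monomials: "c \<in> carrier R \<Longrightarrow> monom_series c g \<in> monomials"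
  by (force simp: monomials_def)

lemma monomials_subset: "monomials \<subseteq> carrier hahn"
  by (auto simp: monomials_def monom_series_closed)

definition indicator_series :: "'g set \<Rightarrow> 'g::linordered_ab_group_add \<Rightarrow> 'a" where
  "indicator_series A = (\<lambda>g. if g \<in> A then \<one> else \<zero>)"

lemma indicator_series_closed: "wfp_on A (<) \<Longrightarrow> indicator_series A \<in> carrier hahn"
  by (auto simp: hahn_carrier_iff indicator_series_def elim: wfp_on_subset)

definition finite_series :: "('g::linordered_ab_group_add \<Rightarrow> 'a) set" where
  "finite_series = {f. range f \<subseteq> carrier R \<and> finite (supp f)}"

lemma finite_series_closed: "f \<in> finite_series \<Longrightarrow> f \<in> carrier hahn"
  by (auto simp: finite_series_def hahn_carrier_iff wfp_on_less_finite)

lemma monomials_finite_series: "monomials \<subseteq> finite_series"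
  by (auto simp: monomials_def finite_series_def monom_series_def)

lemma finite_series_subring: "subring finite_series (hahn :: ('g::linordered_ab_group_add \<Rightarrow> 'a) ring)"
proof -
  interpret H: cring "hahn :: ('g \<Rightarrow> 'a) ring" by (rule hahn_cring)
  show ?thesis
  proof (rule H.subringI)
    show "\<one>\<^bsub>hahn\<^esub> \<in> (finite_series :: ('g \<Rightarrow> 'a) set)"
      unfolding hahn_one_eq_monom_series using monom_series_in_monomials monomials_finite_series
      by blast
    fix f h :: "'g \<Rightarrow> 'a" assume f: "f \<in> finite_series" and h: "h \<in> finite_series"
    note closed = finite_series_closed[OF f] finite_series_closed[OF h]
    have mem: "k \<in> finite_series"
      if "k \<in> carrier hahn" "supp k \<subseteq> A" "finite A" for k :: "'g \<Rightarrow> 'a" and A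
      using that by (auto simp: finite_series_def hahn_carrier_iff intro: finite_subset)
    have fin: "finite (supp f)" "finite (supp h)" using f h by (simp_all add: finite_series_def)
    show "f \<oplus>\<^bsub>hahn\<^esub> h \<in> finite_series"
      using H.a_closed[OF closed] fin by (intro mem[of _ "supp f \<union> supp h"]) (auto simp: hahn_add)
    show "f \<otimes>\<^bsub>hahn\<^esub> h \<in> finite_series"
      using closed fin
      by (intro mem[of _ "supp f + supp h"] supp_hahn_mult_subset finite_set_plus) simp_all
    show "\<ominus>\<^bsub>hahn\<^esub> f \<in> finite_series"
      using H.a_inv_closed[OF closed(1)] fin
      by (intro mem[of _ "supp f"]) (auto simp: hahn_a_inv[OF closed(1)])
  qed (use finite_series_closed in blast)
qed

definition restrict_series :: "'g set \<Rightarrow> ('g \<Rightarrow> 'a) \<Rightarrow> 'g::linordered_ab_group_add \<Rightarrow> 'a" where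
  "restrict_series A f = (\<lambda>g. if g \<in> A then f g else \<zero>)"

lemma restrict_series_eq_iff: "restrict_series A f = restrict_series A h \<longleftrightarrow> (\<forall>g\<in>A. f g = h g)"
  by (auto simp: restrict_series_def fun_eq_iff)

lemma restrict_series_closed: "f \<in> carrier hahn \<Longrightarrow> restrict_series A f \<in> carrier hahn"
  by (auto simp: hahn_carrier_iff restrict_series_def elim!: wfp_on_subset)

lemma restrict_series_mult:
  assumes H: "convex_subgroup H" and f: "f \<in> carrier hahn" "supp f \<subseteq> {0..}"
    and h: "h \<in> carrier hahn" "supp h \<subseteq> {0..}"
  shows "restrict_series H (f \<otimes>\<^bsub>hahn\<^esub> h) = restrict_series H f \<otimes>\<^bsub>hahn\<^esub> restrict_series H h"
proof
  fix g
  have [simp]: "f a \<in> carrier R" "h a \<in> carrier R" for a using hahn_coeff_closed f(1) h(1) by auto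
  show "restrict_series H (f \<otimes>\<^bsub>hahn\<^esub> h) g = (restrict_series H f \<otimes>\<^bsub>hahn\<^esub> restrict_series H h) g"
  proof (cases "g \<in> H")
    case True
    let ?A = "{a. f a \<noteq> \<zero> \<and> h (g - a) \<noteq> \<zero>}"
    have fin: "finite ?A" using f(1) h(1) by (rule finite_hahn_mult_support)
    have in_H: "a \<in> H \<and> g - a \<in> H" if "a \<in> ?A" for a
    proof -
      have "0 \<le> a" "0 \<le> g - a" using that f(2) h(2) by auto
      then have "a \<le> g" "g - a \<le> g" by simp_all
      then show ?thesis using H True \<open>0 \<le> a\<close> \<open>0 \<le> g - a\<close> unfolding convex_subgroup_def by blast
    qed
    have "(f \<otimes>\<^bsub>hahn\<^esub> h) g = (\<Oplus>a\<in>?A. f a \<otimes> h (g - a))"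
      using fin by (intro hahn_mult_eq_finsum f(1) h(1)) auto
    also have "\<dots> = (\<Oplus>a\<in>?A. restrict_series H f a \<otimes> restrict_series H h (g - a))"
      using in_H by (intro finsum_cong') (auto simp: restrict_series_def)
    also have "\<dots> = (restrict_series H f \<otimes>\<^bsub>hahn\<^esub> restrict_series H h) g"
      using fin by (intro hahn_mult_eq_finsum[symmetric] restrict_series_closed f(1) h(1))
        (auto simp: restrict_series_def split: if_splits)
    finally show ?thesis using True by (simp add: restrict_series_def)
  next
    case False
    have "(restrict_series H f \<otimes>\<^bsub>hahn\<^esub> restrict_series H h) g = \<zero>"
    proof (rule ccontr)
      assume "\<not> ?thesis"
      then obtain a b where "g = a + b" "restrict_series H f a \<noteq> \<zero>" "restrict_series H h b \<noteq> \<zero>"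
        using supp_hahn_mult_subset[of "restrict_series H f" "restrict_series H h"]
        by (blast elim: set_plus_elim)
      then have "g = a - (0 - b)" "a \<in> H" "b \<in> H"
        by (simp_all add: restrict_series_def split: if_splits)
      then show False using False H unfolding convex_subgroup_def by blast
    qed
    then show ?thesis using False by (simp add: restrict_series_def)
  qed
qed

end

context field
begin

text \<open>On series with nonnegative exponents, restriction to a convex subgroup \<open>H\<close> is multiplicative; so
  it maps a quotient of finite series to a quotient of finite series with exponents in \<open>H\<close>.\<close>

lemma restrict_series_generate_field_monomials:
  fixes f :: "'g::linordered_ab_group_add \<Rightarrow> 'a"
  assumes H: "convex_subgroup H" and f: "f \<in> generate_field hahn monomials" "supp f \<subseteq> {0..}"
  obtains a b where "a \<in> restrict_series H ` finite_series" "b \<in> restrict_series H ` finite_series"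
    "restrict_series H f = a \<otimes>\<^bsub>hahn\<^esub> inv\<^bsub>hahn\<^esub> b"
proof -
  interpret H: field "hahn :: ('g \<Rightarrow> 'a) ring" by (rule hahn_field)
  have f_closed: "f \<in> carrier hahn" using H.generate_field_in_carrier[OF monomials_subset f(1)] .
  obtain a b where ab: "a \<in> finite_series" "b \<in> finite_series" "b \<noteq> \<zero>\<^bsub>hahn\<^esub>" "f \<otimes>\<^bsub>hahn\<^esub> b = a"
    using H.generate_field_subring_fraction[OF finite_series_subring] f(1)
      H.mono_generate_field[OF monomials_finite_series] finite_series_closed by blast
  define t where "t = monom_series \<one> (- hahn_val b)"
  define b' where "b' = t \<otimes>\<^bsub>hahn\<^esub> b"
  have t: "t \<in> finite_series"
    unfolding t_def using monom_series_in_monomials monomials_finite_series by blast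
  have b': "b' \<in> finite_series" unfolding b'_def using t ab(2)
    by (rule subringE(6)[OF finite_series_subring])
  note closed = finite_series_closed[OF ab(2)] finite_series_closed[OF t] finite_series_closed[OF b']
  have coeff: "b' g = b (g + hahn_val b)" for g
    unfolding b'_def t_def using closed(1) hahn_coeff_closed[OF closed(1)]
    by (simp add: monom_series_mult_coeff)
  have "supp b' \<subseteq> {0..}" using hahn_val_le[OF closed(1)] by (fastforce simp: coeff)
  then have mult: "restrict_series H (f \<otimes>\<^bsub>hahn\<^esub> b')
      = restrict_series H f \<otimes>\<^bsub>hahn\<^esub> restrict_series H b'"
    by (rule restrict_series_mult[OF H f_closed f(2) closed(3)])
  have "0 \<in> H" using H by (simp add: convex_subgroup_def)
  then have "restrict_series H b' 0 \<noteq> \<zero>"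
    using hahn_val_coeff_nonzero[OF closed(1) ab(3)] by (simp add: restrict_series_def coeff)
  then have unit: "restrict_series H b' \<in> Units hahn"
    using restrict_series_closed[OF closed(3)] by (auto simp: H.field_Units hahn_zero)
  have "f \<otimes>\<^bsub>hahn\<^esub> b' = t \<otimes>\<^bsub>hahn\<^esub> a"
    unfolding b'_def ab(4)[symmetric] using f_closed closed(1,2) by (simp add: H.m_lcomm)
  then have "f \<otimes>\<^bsub>hahn\<^esub> b' \<in> finite_series" using t ab(1) subringE(6)[OF finite_series_subring]
    by metis
  moreover have "restrict_series H f = restrict_series H (f \<otimes>\<^bsub>hahn\<^esub> b')
        \<otimes>\<^bsub>hahn\<^esub> inv\<^bsub>hahn\<^esub> (restrict_series H b')"
    unfolding mult using unit restrict_series_closed[OF f_closed] restrict_series_closed[OF closed(3)]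
    by (simp add: H.m_assoc)
  ultimately show thesis using b' by (intro that) auto
qed

lemma countable_restrict_generate_field_monomials:
  fixes H :: "'g::linordered_ab_group_add set"
  assumes "convex_subgroup H" "countable H" "countable (carrier R)"
  shows "countable (restrict_series H ` {f \<in> generate_field hahn monomials. supp f \<subseteq> {0..}})"
proof -
  let ?F = "restrict_series H ` finite_series"
  have "restrict_series H f \<in> finite_support_functions \<zero> H (carrier R)"
    if f: "f \<in> finite_series" for f
  proof -
    have "supp (restrict_series H f) \<subseteq> supp f" by (auto simp: restrict_series_def)
    then have "finite (supp (restrict_series H f))"
      using f by (auto simp: finite_series_def intro: finite_subset)
    then show ?thesis
      using f by (auto simp: finite_support_functions_def finite_series_def
        restrict_series_def split: if_splits)
  qed
  then have "?F \<subseteq> finite_support_functions \<zero> H (carrier R)" by blast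
  then have "countable ?F"
    using countable_finite_support_functions[OF assms(2,3)] by (rule countable_subset)
  then have "countable ((\<lambda>(a, b). a \<otimes>\<^bsub>hahn\<^esub> inv\<^bsub>hahn\<^esub> b) ` (?F \<times> ?F))" by simp
  moreover have "restrict_series H ` {f \<in> generate_field hahn monomials. supp f \<subseteq> {0..}} \<subseteq>
      (\<lambda>(a, b). a \<otimes>\<^bsub>hahn\<^esub> inv\<^bsub>hahn\<^esub> b) ` (?F \<times> ?F)"
    using restrict_series_generate_field_monomials[OF assms(1)] by (clarsimp simp: image_iff) metis
  ultimately show ?thesis by (rule countable_subset[rotated])
qed

end

locale embedded_hahn_field = field Q + K: field K
  for Q :: "('q, 'm) ring_scheme" (structure) and K :: "('k, 'n) ring_scheme" +
  fixes e :: "'q \<Rightarrow> 'g::linordered_ab_group_add \<Rightarrow> 'k"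
  assumes e_hom: "e \<in> ring_hom Q (hahn_ring K)"
    and monomials_subset_range: "K.monomials \<subseteq> e ` carrier Q"
begin

sublocale e: ring_hom_ring Q "hahn_ring K" e
  using ring_axioms cring.axioms(1)[OF K.hahn_cring] e_hom by (rule ring_hom_ringI2)

sublocale valued_field Q "\<lambda>x. K.hahn_val (e x)"
proof (rule valued_field.valued_field_comp_ring_hom[OF K.hahn_valued_field field_axioms e_hom])
  fix g :: 'g
  have "K.monom_series \<one>\<^bsub>K\<^esub> g \<in> e ` carrier Q"
    using monomials_subset_range K.monom_series_in_monomials[OF K.one_closed] by blast
  then obtain x where x: "x \<in> carrier Q" "e x = K.monom_series \<one>\<^bsub>K\<^esub> g" by auto
  then have "x \<noteq> \<zero>" using K.monom_series_nonzero[OF K.one_not_zero] e.hom_zero by metis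
  moreover have "K.hahn_val (e x) = g" unfolding x(2)
    by (rule K.hahn_val_monom_series[OF K.one_not_zero])
  ultimately show "\<exists>x\<in>carrier Q. x \<noteq> \<zero> \<and> K.hahn_val (e x) = g" using x(1) by blast
qed

lemma e_coeff_closed: "x \<in> carrier Q \<Longrightarrow> e x g \<in> carrier K"
  by (rule K.hahn_coeff_closed[OF e.hom_closed])

lemma e_eq_zero_iff: "x \<in> carrier Q \<Longrightarrow> e x = \<zero>\<^bsub>hahn_ring K\<^esub> \<longleftrightarrow> x = \<zero>"
  using inj_onD[OF non_trivial_field_hom_is_inj[OF e_hom field_axioms K.hahn_field], of x \<zero>] by auto

lemma mem_value_ideal_iff_coeff:
  assumes "x \<in> carrier Q"
  shows "x \<in> value_ideal g \<longleftrightarrow> (\<forall>a<g. e x a = \<zero>\<^bsub>K\<^esub>)"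
  using K.hahn_val_ge_iff[OF e.hom_closed[OF assms], of g] assms
  by (simp add: value_ideal_def e_eq_zero_iff)

lemma supp_nonneg_if_valuation_ring: "x \<in> valuation_ring \<Longrightarrow> K.supp (e x) \<subseteq> {0..}"
  using mem_value_ideal_iff_coeff[of x 0] value_ideal_carrier[of x 0] by (force simp: not_le)

lemma const_coeff_hom: "(\<lambda>x. e x 0) \<in> ring_hom (Q\<lparr>carrier := valuation_ring\<rparr>) K"
proof (rule ring_hom_memI)
  let ?V = "Q\<lparr>carrier := valuation_ring\<rparr>"
  fix x y assume "x \<in> carrier ?V" "y \<in> carrier ?V"
  then have xy: "x \<in> valuation_ring" "y \<in> valuation_ring" by simp_all
  note closed = xy[THEN value_ideal_carrier]
  show "e x 0 \<in> carrier K" using closed(1) by (rule e_coeff_closed)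
  have "(e x \<otimes>\<^bsub>hahn_ring K\<^esub> e y) (0 + 0) = e x 0 \<otimes>\<^bsub>K\<^esub> e y 0"
    using closed xy[THEN supp_nonneg_if_valuation_ring] by (intro K.hahn_mult_lowest_coeff) auto
  then show "e (x \<otimes>\<^bsub>?V\<^esub> y) 0 = e x 0 \<otimes>\<^bsub>K\<^esub> e y 0" using closed by simp
  show "e (x \<oplus>\<^bsub>?V\<^esub> y) 0 = e x 0 \<oplus>\<^bsub>K\<^esub> e y 0" using closed by (simp add: K.hahn_add)
qed (simp add: K.hahn_one)

lemma const_coeff_eq_zero_iff:
  assumes x: "x \<in> valuation_ring"
  shows "e x 0 = \<zero>\<^bsub>K\<^esub> \<longleftrightarrow> x \<notin> Units (Q\<lparr>carrier := valuation_ring\<rparr>)"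
proof (cases "x = \<zero>")
  case False
  note ex = e.hom_closed[OF value_ideal_carrier[OF x]]
  have "0 \<le> K.hahn_val (e x)" "e x \<noteq> \<zero>\<^bsub>hahn_ring K\<^esub>"
    using x False by (simp_all add: value_ideal_def e_eq_zero_iff)
  then have "K.hahn_val (e x) = 0 \<longleftrightarrow> e x 0 \<noteq> \<zero>\<^bsub>K\<^esub>"
    using K.hahn_val_coeff_nonzero[OF ex] K.hahn_val_le[OF ex, of 0] by force
  then show ?thesis using False value_ideal_carrier[OF x] by (auto simp: Units_valuation_ring)
qed (simp add: K.hahn_zero Units_valuation_ring)

lemma residue_field_iso: "residue_field Q valuation_ring \<simeq> K"
proof -
  let ?V = "Q\<lparr>carrier := valuation_ring\<rparr>" and ?const = "\<lambda>x. e x 0"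
  interpret const: ring_hom_ring ?V K ?const
    using subring_is_ring[OF subring_valuation_ring] K.ring_axioms const_coeff_hom
    by (rule ring_hom_ringI2)
  have "{x \<in> valuation_ring. e x 0 = \<zero>\<^bsub>K\<^esub>} = valuation_ring - Units ?V"
    using const_coeff_eq_zero_iff by blast
  then have "a_kernel ?V K ?const = max_ideal Q valuation_ring"
    unfolding a_kernel_def' max_ideal_def partial_object.select_convs partial_object.update_convs
    by simp
  moreover have "c \<in> ?const ` valuation_ring" if c: "c \<in> carrier K" for c
  proof -
    obtain x where x: "x \<in> carrier Q" "e x = K.monom_series c 0"
      using K.monom_series_in_monomials[OF c] monomials_subset_range by (metis imageE subsetD)
    then have "x \<in> valuation_ring" by (simp add: mem_value_ideal_iff_coeff K.monom_series_def)
    then show ?thesis using x(2) by (intro image_eqI[of _ _ x]) (simp_all add: K.monom_series_def)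
  qed
  then have "?const ` carrier ?V = carrier K" using e_coeff_closed value_ideal_carrier by auto
  ultimately show ?thesis unfolding residue_field_def using const.FactRing_iso by simp
qed

lemma l_coset_value_ideal_eq_iff_coeff:
  assumes "x \<in> carrier Q" "y \<in> carrier Q"
  shows "x <+ value_ideal g = y <+ value_ideal g \<longleftrightarrow> (\<forall>a<g. e x a = e y a)"
proof -
  have "e (x \<ominus> y) a = e x a \<ominus>\<^bsub>K\<^esub> e y a" for a
    using assms by (simp add: a_minus_def K.hahn_add K.hahn_a_inv)
  then show ?thesis
    using assms e_coeff_closed by (simp add: l_coset_value_ideal_eq_iff mem_value_ideal_iff_coeff)
qed

lemma uncountable_cosets_if_indicator_series:
  fixes \<gamma> :: "nat \<Rightarrow> 'g"
  assumes unc: "uncountable I" and range: "(\<lambda>N. K.indicator_series (\<gamma> ` N)) ` I \<subseteq> e ` carrier Q"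
    and \<gamma>: "strict_mono \<gamma>" "\<And>n. 0 \<le> \<gamma> n" "\<And>n. \<gamma> n < g"
  shows "uncountable (cosets_in Q valuation_ring (value_ideal g))"
proof
  let ?f = "\<lambda>N. K.indicator_series (\<gamma> ` N)"
  define x where "x N = inv_into (carrier Q) e (?f N)" for N
  have x: "x N \<in> carrier Q" "e (x N) = ?f N" if "N \<in> I" for N
  proof -
    have "?f N \<in> e ` carrier Q" using range that by blast
    then show "x N \<in> carrier Q" "e (x N) = ?f N" unfolding x_def
      by (rule inv_into_into, rule f_inv_into_f)
  qed
  assume "countable (cosets_in Q valuation_ring (value_ideal g))"
  moreover have "x N \<in> valuation_ring" if "N \<in> I" for N
    using x[OF that] \<gamma>(2)
    by (auto simp: mem_value_ideal_iff_coeff K.indicator_series_def not_less[symmetric])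
  ultimately have "countable ((\<lambda>N. x N <+ value_ideal g) ` I)"
    unfolding cosets_in_eq_image by (auto elim: countable_subset[rotated])
  moreover have "inj_on (\<lambda>N. x N <+ value_ideal g) I"
  proof (rule inj_onI)
    fix M N assume MN: "M \<in> I" "N \<in> I" "x M <+ value_ideal g = x N <+ value_ideal g"
    then have "\<forall>a<g. ?f M a = ?f N a" using x l_coset_value_ideal_eq_iff_coeff by metis
    then have "?f M (\<gamma> n) = ?f N (\<gamma> n)" for n using \<gamma>(3) by blast
    then have "n \<in> M \<longleftrightarrow> n \<in> N" for n
      using inj_image_mem_iff[OF strict_mono_imp_inj_on[OF \<gamma>(1)]] K.one_not_zero
      unfolding K.indicator_series_def by metis
    then show "M = N" by blast
  qed
  ultimately show False using unc countable_image_inj_on by blast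
qed

lemma countable_cosets_if_generated_by_monomials:
  assumes gen: "e ` carrier Q = generate_field (hahn_ring K) K.monomials"
    and H: "convex_subgroup H" "countable H" "g \<in> H" and K: "countable (carrier K)"
  shows "countable (cosets_in Q valuation_ring (value_ideal g))"
  unfolding cosets_in_eq_image
proof (rule countable_image_factor)
  have "K.restrict_series H ` e ` valuation_ring \<subseteq>
      K.restrict_series H ` {f \<in> generate_field (hahn_ring K) K.monomials. K.supp f \<subseteq> {0..}}"
    unfolding gen[symmetric] using supp_nonneg_if_valuation_ring value_ideal_carrier by blast
  then show "countable ((\<lambda>x. K.restrict_series H (e x)) ` valuation_ring)"
    using K.countable_restrict_generate_field_monomials[OF H(1,2) K]
    by (simp add: image_image countable_subset)
  fix x y assume xy: "x \<in> valuation_ring" "y \<in> valuation_ring"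
    and eq: "K.restrict_series H (e x) = K.restrict_series H (e y)"
  have "e x a = e y a" if "a < g" for a
  proof (cases "0 \<le> a")
    case True
    then have "a \<in> H" using H(1,3) that by (auto simp: convex_subgroup_def)
    then show ?thesis using eq by (simp add: K.restrict_series_eq_iff)
  next
    case False
    then show ?thesis using xy[THEN supp_nonneg_if_valuation_ring] by force
  qed
  then show "x <+ value_ideal g = y <+ value_ideal g"
    using xy by (simp add: l_coset_value_ideal_eq_iff_coeff value_ideal_carrier)
qed

end

lemma (in field) exists_nat_set_copy:
  assumes "|carrier R| \<le>o aleph1"
  obtains Q :: "nat set ring" and e where "field Q" "e \<in> ring_iso Q R" "|carrier Q| \<le>o aleph1"
proof -
  have "|carrier R| \<le>o |omega1_idx|"
    using assms card_of_Field_ordIso[of aleph1] Cinfinite_aleph1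
    by (blast intro: ordLeq_ordIso_trans ordIso_symmetric)
  then obtain f :: "_ \<Rightarrow> nat set" where f: "inj_on f (carrier R)"
    by (auto simp: card_of_ordLeq[symmetric])
  have "inv_into (carrier R) f \<in> ring_iso (image_ring f R) R"
    using ring_axioms f by (intro ring_iso_set_sym inj_imp_image_ring_iso)
  moreover have "|carrier (image_ring f R)| \<le>o aleph1"
    unfolding image_ring_carrier using assms by (rule ordLeq_image)
  ultimately show thesis using inj_imp_image_ring_is_field[OF f] that by blast
qed

lemma (in field) exists_embedded_hahn_field:
  fixes S :: "(value_grp \<Rightarrow> 'a) set"
  assumes S: "monomials \<subseteq> S" "S \<subseteq> carrier hahn" "|S| \<le>o aleph1"
  obtains Q :: "nat set ring" and e where "embedded_hahn_field Q R e"
    "omega1_valued_field Q (\<lambda>x. hahn_val (e x)) unit_value" "e ` carrier Q = generate_field hahn S"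
proof -
  interpret H: field "hahn :: (value_grp \<Rightarrow> 'a) ring" by (rule hahn_field)
  let ?F = "generate_field hahn S"
  interpret F: field "hahn\<lparr>carrier := ?F\<rparr>" by (rule H.generate_field_is_field[OF S(2)])
  have "|?F| \<le>o aleph1" by (rule generate_field_Cinfinite_bound[OF S(3) Cinfinite_aleph1])
  then obtain Q :: "nat set ring" and e
    where Q: "field Q" "e \<in> ring_iso Q (hahn\<lparr>carrier := ?F\<rparr>)" "|carrier Q| \<le>o aleph1"
    using F.exists_nat_set_copy by auto
  have range: "e ` carrier Q = ?F" using Q(2) by (simp add: ring_iso_def bij_betw_def)
  have "e \<in> ring_hom Q hahn"
    using Q(2) H.generate_field_incl[OF S(2)] by (auto simp: ring_iso_def ring_hom_def)
  moreover have "monomials \<subseteq> e ` carrier Q" unfolding range using S(1)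
    by (auto intro: generate_field.incl)
  ultimately have embedded: "embedded_hahn_field Q R e"
    using Q(1) by (intro embedded_hahn_field.intro embedded_hahn_field_axioms.intro field_axioms)
  then interpret E: embedded_hahn_field Q R e .
  have "omega1_valued_field Q (\<lambda>x. hahn_val (e x)) unit_value"
  proof
    show "\<exists>i. g < unit_value i" for g using exists_level level_less_unit_value by metis
  qed (simp_all add: unit_value_less unit_value_pos Q(3))
  then show thesis using that embedded range by blast
qed

lemma (in field) monomials_ordLeq_aleph1:
  "countable (carrier R) \<Longrightarrow> |monomials :: (value_grp \<Rightarrow> 'a) set| \<le>o aleph1"
  unfolding monomials_def
  by (intro ordLeq_image Times_Cinfinite_bound countable_Cinfinite_bound
      Cinfinite_aleph1 value_grp_ordLeq_aleph1)

lemma (in field) exists_essentially_uncountable_type: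
  assumes "countable (carrier R)"
  obtains Q :: "nat set ring" and v where "omega1_valued_field Q v unit_value"
    "residue_field Q (valued_field.valuation_ring Q v) \<simeq> R"
    "essentially_uncountable_type Q (valued_field.valuation_ring Q v) (carrier Q)"
proof -
  obtain \<gamma> :: "nat \<Rightarrow> value_grp" and g where \<gamma>: "strict_mono \<gamma>" "\<And>n. 0 \<le> \<gamma> n" "\<And>n. \<gamma> n < g"
    by (rule exists_bounded_strict_mono) blast
  define P where "P = (\<lambda>N. indicator_series (\<gamma> ` N)) ` omega1_idx"
  have "wfp_on (\<gamma> ` N) (<)" for N
    using wfp_on_less_range_strict_mono[OF \<gamma>(1)] by (rule wfp_on_subset) blast
  then have closed: "monomials \<union> P \<subseteq> carrier hahn"
    using monomials_subset indicator_series_closed by (auto simp: P_def)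
  have "|P| \<le>o aleph1"
    unfolding P_def using Cinfinite_aleph1
    by (intro ordLeq_image ordIso_imp_ordLeq card_of_Field_ordIso) simp
  then have "|monomials \<union> P| \<le>o aleph1"
    using monomials_ordLeq_aleph1[OF assms] Cinfinite_aleph1 by (intro Un_Cinfinite_bound)
  then obtain Q :: "nat set ring" and e where Q: "embedded_hahn_field Q R e"
    "omega1_valued_field Q (\<lambda>x. hahn_val (e x)) unit_value"
    "e ` carrier Q = generate_field hahn (monomials \<union> P)"
    using exists_embedded_hahn_field[OF _ closed] by blast
  interpret E: embedded_hahn_field Q R e by (rule Q)
  interpret V: omega1_valued_field Q "\<lambda>x. hahn_val (e x)" unit_value by (rule Q)
  have "P \<subseteq> e ` carrier Q" unfolding Q(3) by (auto intro: generate_field.incl)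
  then have "uncountable (cosets_in Q E.valuation_ring (E.value_ideal g))"
    using \<gamma> by (intro E.uncountable_cosets_if_indicator_series[OF uncountable_omega1_idx])
        (auto simp: P_def)
  then show thesis
    using that Q(2) E.residue_field_iso V.essentially_uncountable_type_valuation_ring by blast
qed

lemma (in field) exists_strongly_countable_type:
  assumes "countable (carrier R)"
  obtains Q :: "nat set ring" and v where "omega1_valued_field Q v unit_value"
    "residue_field Q (valued_field.valuation_ring Q v) \<simeq> R"
    "strongly_countable_type Q (valued_field.valuation_ring Q v) (carrier Q)"
proof -
  obtain Q :: "nat set ring" and e :: "nat set \<Rightarrow> value_grp \<Rightarrow> 'a"
    where Q: "embedded_hahn_field Q R e"
    "omega1_valued_field Q (\<lambda>x. hahn_val (e x)) unit_value"
    "e ` carrier Q = generate_field hahn monomials"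
    using exists_embedded_hahn_field[OF order_refl monomials_subset
        monomials_ordLeq_aleph1[OF assms]] by blast
  interpret E: embedded_hahn_field Q R e by (rule Q)
  interpret V: omega1_valued_field Q "\<lambda>x. hahn_val (e x)" unit_value by (rule Q)
  have "countable (cosets_in Q E.valuation_ring (E.value_ideal g))" for g
  proof -
    obtain \<sigma> where "g \<in> level \<sigma>" by (rule exists_level)
    then show ?thesis
      using E.countable_cosets_if_generated_by_monomials[OF Q(3) convex_subgroup_level
          countable_level _ assms]
      by blast
  qed
  then show thesis
    using that Q(2) E.residue_field_iso V.strongly_countable_type_valuation_ring by blast
qed

theorem mainTheorem2:
  fixes K :: "('k, 'e) ring_scheme"
  assumes "field K" and "countable (carrier K)"
  shows "\<exists>(Q1 :: nat set ring) R1 (Q2 :: nat set ring) R2.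
    valuation_domain_in Q1 R1 \<and> valuation_domain_in Q2 R2 \<and>
    card_eq_aleph1 R1 \<and> card_eq_aleph1 R2 \<and>
    residue_field Q1 R1 \<simeq> K \<and> residue_field Q2 R2 \<simeq> K \<and>
    same_value_group Q1 R1 Q2 R2 \<and>
    (\<exists>S \<subseteq> carrier Q1. card_le_aleph1 S \<and> rspan Q1 R1 S = carrier Q1) \<and>
    (\<forall>S \<subseteq> carrier Q1. countable S \<longrightarrow> rspan Q1 R1 S \<noteq> carrier Q1) \<and>
    (\<exists>S \<subseteq> carrier Q2. card_le_aleph1 S \<and> rspan Q2 R2 S = carrier Q2) \<and>
    (\<forall>S \<subseteq> carrier Q2. countable S \<longrightarrow> rspan Q2 R2 S \<noteq> carrier Q2) \<and>
    essentially_uncountable_type Q1 R1 (carrier Q1) \<and>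
    strongly_countable_type Q2 R2 (carrier Q2)"
proof -
  interpret K: field K by fact
  obtain Q1 :: "nat set ring" and v1 where Q1: "omega1_valued_field Q1 v1 unit_value"
    "residue_field Q1 (valued_field.valuation_ring Q1 v1) \<simeq> K"
    "essentially_uncountable_type Q1 (valued_field.valuation_ring Q1 v1) (carrier Q1)"
    using K.exists_essentially_uncountable_type[OF assms(2)] .
  obtain Q2 :: "nat set ring" and v2 where Q2: "omega1_valued_field Q2 v2 unit_value"
    "residue_field Q2 (valued_field.valuation_ring Q2 v2) \<simeq> K"
    "strongly_countable_type Q2 (valued_field.valuation_ring Q2 v2) (carrier Q2)"
    using K.exists_strongly_countable_type[OF assms(2)] .
  interpret Q1: omega1_valued_field Q1 v1 unit_value by fact
  interpret Q2: omega1_valued_field Q2 v2 unit_value by fact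
  have "same_value_group Q1 Q1.valuation_ring Q2 Q2.valuation_ring"
    by (rule same_value_group_valuation_ring) unfold_locales
  then show ?thesis
    using Q1 Q2 Q1.valuation_domain_in_valuation_ring Q2.valuation_domain_in_valuation_ring
      Q1.card_eq_aleph1_valuation_ring Q2.card_eq_aleph1_valuation_ring
      Q1.aleph1_generated Q2.aleph1_generated
      Q1.not_countably_generated Q2.not_countably_generated
    by (intro exI[of _ Q1] exI[of _ Q1.valuation_ring] exI[of _ Q2] exI[of _ Q2.valuation_ring]) simp
qed

end
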